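(* Let $a,b>0$ be real numbers. For any $(\gamma,\delta)\in\mathbb R^2$ with $$\gamma\ge -2/a,\qquad \delta\le 2/b,\qquad \gamma-\delta\le 2,$$ the system $$u_{z\bar z}= e^{au}-e^{v-u},\qquad v_{z\bar z}= e^{v-u}-e^{-bv}$$ has a unique solution $(u,v)$, with $u,v:\mathbb C^*\to\mathbb R$ smooth on all of $\mathbb C^*$, such that $$u(z)\to 0,\quad v(z)\to 0\quad\text{as } |z|\to\infty,$$ $$u(z)=(\gamma+o(1))\log|z|,\quad v(z)=(\delta+o(1))\log|z|\quad\text{as } |z|\to 0.$$ When $(\gamma,\delta)$ is in the interior of this region, one has moreover $$u(z)=\gamma\log|z|+O(1),\quad v(z)=\delta\log|z|+O(1)\quad\text{as } |z|\to 0.$$ The functions $u,v$ depend only on $|z|$.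
   Context: $\mathbb C^*=\mathbb C\setminus\{0\}$; $z$ is the standard complex coordinate and $u_{z\bar z}=\frac{\partial^2u}{\partial z\,\partial\bar z}=\frac14\Delta u$, where $\Delta$ is the Laplacian on $\mathbb R^2=\mathbb C$. *)

theory Defs
  imports "HOL-Analysis.Analysis" "HOL-Library.Landau_Symbols"
begin

primrec Ck_on :: "nat \<Rightarrow> 'a::euclidean_space set \<Rightarrow> ('a \<Rightarrow> 'b::real_normed_vector) \<Rightarrow> bool" where
  "Ck_on 0 S f \<longleftrightarrow> continuous_on S f"
| "Ck_on (Suc k) S f \<longleftrightarrow>
     (\<forall>x\<in>S. f differentiable (at x)) \<and>
     (\<forall>h. Ck_on k S (\<lambda>x. frechet_derivative f (at x) h))"

text \<open>For open sets only: derivatives are taken with respect to full neighbourhoods.\<close>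

definition smooth_on :: "'a::euclidean_space set \<Rightarrow> ('a \<Rightarrow> 'b::real_normed_vector) \<Rightarrow> bool" where
  "smooth_on S f \<longleftrightarrow> (\<forall>k. Ck_on k S f)"

definition laplacian :: "('a::euclidean_space \<Rightarrow> real) \<Rightarrow> 'a \<Rightarrow> real" where
  "laplacian f x =
     (\<Sum>b\<in>Basis. frechet_derivative (\<lambda>y. frechet_derivative f (at y) b) (at x) b)"

lemma laplacian_complex:
  fixes f :: "complex \<Rightarrow> real"
  shows "laplacian f z =
           frechet_derivative (\<lambda>w. frechet_derivative f (at w) 1) (at z) 1 +
           frechet_derivative (\<lambda>w. frechet_derivative f (at w) \<i>) (at z) \<i>"
  by (simp add: laplacian_def Basis_complex_def)

text \<open>The second-order operator \<open>\<partial>\<^sup>2/\<partial>z\<partial>z'\<close>, where \<open>z'\<close> is the conjugate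
  coordinate of \<open>z\<close>, on real-valued functions.\<close>

definition d_z_zbar :: "(complex \<Rightarrow> real) \<Rightarrow> complex \<Rightarrow> real" where
  "d_z_zbar f z = laplacian f z / 4"

text \<open>Functions on the punctured plane are represented by total functions whose value
  at \<open>0\<close> is irrelevant.\<close>

definition solves_system ::
  "real \<Rightarrow> real \<Rightarrow> (complex \<Rightarrow> real) \<Rightarrow> (complex \<Rightarrow> real) \<Rightarrow> bool" where
  "solves_system a b u v \<longleftrightarrow>
     smooth_on (- {0}) u \<and> smooth_on (- {0}) v \<and>
     (\<forall>z. z \<noteq> 0 \<longrightarrow>
        d_z_zbar u z = exp (a * u z) - exp (v z - u z) \<and>
        d_z_zbar v z = exp (v z - u z) - exp (- b * v z))"

definition log_asymptotics :: "real \<Rightarrow> (complex \<Rightarrow> real) \<Rightarrow> bool" where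
  "log_asymptotics c f \<longleftrightarrow>
     (\<exists>\<epsilon>. (\<epsilon> \<longlongrightarrow> 0) (at 0) \<and>
          (\<forall>\<^sub>F z in at 0. f z = (c + \<epsilon> z) * ln (cmod z)))"

definition is_solution ::
  "real \<Rightarrow> real \<Rightarrow> real \<Rightarrow> real \<Rightarrow> (complex \<Rightarrow> real) \<Rightarrow> (complex \<Rightarrow> real) \<Rightarrow> bool" where
  "is_solution a b \<gamma> \<delta> u v \<longleftrightarrow>
     solves_system a b u v \<and>
     (u \<longlongrightarrow> 0) at_infinity \<and> (v \<longlongrightarrow> 0) at_infinity \<and>
     log_asymptotics \<gamma> u \<and> log_asymptotics \<delta> v"

definition region :: "real \<Rightarrow> real \<Rightarrow> (real \<times> real) set" where
  "region a b = {(\<gamma>, \<delta>). \<gamma> \<ge> - 2 / a \<and> \<delta> \<le> 2 / b \<and> \<gamma> - \<delta> \<le> 2}"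

end

(*
  Write t = ln |z|.  For radial functions the system becomes u'' = 4 e^(2t) (e^(au) - e^(v-u)),
  v'' = 4 e^(2t) (e^(v-u) - e^(-bv)).  It is cooperative: the difference of a solution and a supersolution
  cannot have a positive maximum, neither along the line nor on the punctured plane.

  Existence: on [-T, T] with boundary values (-gamma T, -delta T) and (0, 0), monotone iteration starting from a
  large constant gives a solution.  Bounds independent of T come from the supersolution (N e^(-2t), q N e^(-2t)),
  valid for all t, and, for t <= 0, from (gamma t, delta t) corrected by multiples of ln(1 - t), or, in the
  interior of the region, by bounded exponentials.  Lower bounds follow from the symmetry
  (u, v, a, b, gamma, delta) -> (-v, -u, b, a, -delta, -gamma).  Comparison with small affine functions of t then
  shows that the solutions on [-T, T] converge as T -> infinity.

  Uniqueness: the same comparison on an annulus, with slack eta + eps (ln R - ln |z|), which is harmonic and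
  dominates the o(ln |z|) difference of two solutions near 0.
*)
theory Submission
  imports Defs "HOL-Real_Asymp.Real_Asymp"
begin

section \<open>Second derivatives on the line and the maximum principle\<close>

text \<open>No compactness theorem for families of functions is used. Limits pass through an
  integral representation free of derivatives, by dominated convergence; this needs only bounds on
  the right-hand sides and pointwise convergence, which comes from monotonicity for the iteration
  and from comparison as T grows. The delicate end is t -> -infinity. Along u = \<gamma> t, v =
  \<delta> t the exponential terms, multiplied by exp(2t), have exponents 2 + a \<gamma>, 2 +
  \<delta> - \<gamma> and 2 - b \<delta> in t, and the region says exactly that these are
  nonnegative. Positive exponents leave a decaying source, which a bounded correction absorbs. A
  zero exponent leaves a source that a bounded correction q cannot absorb, since q'' <= -k exp(-b q)
  is impossible for bounded q on a half-line; a multiple of ln(1 - t) satisfies it, as in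
  Liouville's equation. The resulting logarithmic error is still o(T), so an affine function of
  slope o(1) dominates the difference of two truncated solutions at the left end. The supersolution
  N exp(-2t) is crude, but at -T it beats the linear boundary values and at +infinity it forces
  decay.\<close>

text \<open>The first derivative stays hidden because the maximum principle only sees the second.
  Derivatives are two-sided, so \<open>I\<close> is meant to be open; continuity up to the end
  points is stated separately where it is needed.\<close>

definition has_deriv2_on :: "(real \<Rightarrow> real) \<Rightarrow> (real \<Rightarrow> real) \<Rightarrow> real set \<Rightarrow> bool" where
  "has_deriv2_on f f2 I \<longleftrightarrow>
     (\<exists>f1. \<forall>t\<in>I. (f has_real_derivative f1 t) (at t) \<and> (f1 has_real_derivative f2 t) (at t))"

lemma has_deriv2_onI:
  assumes "\<And>t. t \<in> I \<Longrightarrow> (f has_real_derivative f1 t) (at t)"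
    and "\<And>t. t \<in> I \<Longrightarrow> (f1 has_real_derivative f2 t) (at t)"
  shows "has_deriv2_on f f2 I"
  using assms unfolding has_deriv2_on_def by blast

lemma has_deriv2_on_subset: "has_deriv2_on f f2 I \<Longrightarrow> J \<subseteq> I \<Longrightarrow> has_deriv2_on f f2 J"
  unfolding has_deriv2_on_def by blast

lemma has_deriv2_on_cong: "has_deriv2_on f f2 I \<Longrightarrow> (\<And>t. t \<in> I \<Longrightarrow> f2 t = g2 t) \<Longrightarrow> has_deriv2_on f g2 I"
  unfolding has_deriv2_on_def by simp

lemma has_deriv2_on_add:
  assumes "has_deriv2_on f f2 I" "has_deriv2_on g g2 I"
  shows "has_deriv2_on (\<lambda>t. f t + g t) (\<lambda>t. f2 t + g2 t) I"
proof -
  obtain f1 g1 where "\<forall>t\<in>I. (f has_real_derivative f1 t) (at t) \<and> (f1 has_real_derivative f2 t) (at t)"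
    "\<forall>t\<in>I. (g has_real_derivative g1 t) (at t) \<and> (g1 has_real_derivative g2 t) (at t)"
    using assms unfolding has_deriv2_on_def by blast
  then show ?thesis
    by (intro has_deriv2_onI[where ?f1.0 = "\<lambda>t. f1 t + g1 t"]) (auto intro!: derivative_intros)
qed

lemma has_deriv2_on_minus:
  assumes "has_deriv2_on f f2 I"
  shows "has_deriv2_on (\<lambda>t. - f t) (\<lambda>t. - f2 t) I"
proof -
  obtain f1 where "\<forall>t\<in>I. (f has_real_derivative f1 t) (at t) \<and> (f1 has_real_derivative f2 t) (at t)"
    using assms unfolding has_deriv2_on_def by blast
  then show ?thesis
    by (intro has_deriv2_onI[where ?f1.0 = "\<lambda>t. - f1 t"]) (auto intro!: derivative_intros)
qed

lemma has_deriv2_on_diff: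
  assumes "has_deriv2_on f f2 I" "has_deriv2_on g g2 I"
  shows "has_deriv2_on (\<lambda>t. f t - g t) (\<lambda>t. f2 t - g2 t) I"
  using has_deriv2_on_add[OF assms(1) has_deriv2_on_minus[OF assms(2)]] by simp

lemma has_deriv2_on_affine: "has_deriv2_on (\<lambda>t. p + q * t) (\<lambda>_. 0) I"
  by (intro has_deriv2_onI[where ?f1.0 = "\<lambda>_. q"]) (auto intro!: derivative_eq_intros)

text \<open>At a local maximum \<open>f1 t = 0\<close>, and \<open>f2 t > 0\<close> makes
  \<open>f1\<close> positive just to the right, so \<open>f\<close> increases there. Only the sign
  of \<open>f2\<close> at the one point \<open>t\<close> enters; \<open>f2\<close> may be
  discontinuous.\<close>

lemma deriv2_pos_not_local_max:
  assumes f: "has_deriv2_on f f2 I" and I: "open I" "t \<in> I" and pos: "f2 t > 0" and e: "0 < e"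
  shows "\<exists>s. \<bar>s - t\<bar> < e \<and> f t < f s"
proof (rule ccontr)
  assume "\<not> ?thesis"
  then have le: "\<forall>s. \<bar>t - s\<bar> < e \<longrightarrow> f s \<le> f t"
    by (metis abs_minus_commute not_less)
  obtain f1 where f1: "\<forall>t\<in>I. (f has_real_derivative f1 t) (at t) \<and> (f1 has_real_derivative f2 t) (at t)"
    using f unfolding has_deriv2_on_def by blast
  have "f1 t = 0"
    using DERIV_local_max[of f "f1 t" t e] f1 I le e by blast
  obtain d where d: "d > 0" "\<And>h. 0 < h \<Longrightarrow> h < d \<Longrightarrow> f1 t < f1 (t + h)"
    using DERIV_pos_inc_right[of f1 "f2 t" t] f1 I pos by blast
  obtain r where r: "r > 0" "ball t r \<subseteq> I" using I open_contains_ball by blast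
  define m where "m = min d (min e r) / 2"
  have m: "0 < m" "m < d" "m < e" "m < r" using d r e by (auto simp: m_def)
  have inI: "x \<in> I" if "t \<le> x" "x \<le> t + m" for x
    using that m r by (auto simp: dist_real_def subset_iff)
  have "f t < f (t + m)"
  proof (rule DERIV_pos_imp_increasing_open[where f = f])
    show "t < t + m" using m by simp
    show "\<exists>y. DERIV f x :> y \<and> 0 < y" if "t < x" "x < t + m" for x
      using f1 inI[of x] d(2)[of "x - t"] that m \<open>f1 t = 0\<close> by auto
    show "continuous_on {t..t + m} f"
      using f1 inI by (meson DERIV_isCont atLeastAtMost_iff continuous_at_imp_continuous_on)
  qed
  with le[rule_format, of "t + m"] m show False by auto
qed

text \<open>If the maximum of \<open>max f g\<close> over \<open>S\<close> were positive, the
  function attaining it would dominate the other at that point, so its hypothesis would supply a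
  still larger value in \<open>S\<close>. No derivative appears, so that the lemma serves both
  intervals and annuli.\<close>

lemma compact_pair_max_principle:
  fixes f g :: "'a::topological_space \<Rightarrow> real"
  assumes S: "compact S" and cont: "continuous_on S f" "continuous_on S g"
    and f: "\<And>z. z \<in> S \<Longrightarrow> 0 < f z \<Longrightarrow> g z \<le> f z \<Longrightarrow> \<exists>w\<in>S. f z < f w"
    and g: "\<And>z. z \<in> S \<Longrightarrow> 0 < g z \<Longrightarrow> f z \<le> g z \<Longrightarrow> \<exists>w\<in>S. g z < g w"
    and z: "z \<in> S"
  shows "f z \<le> 0 \<and> g z \<le> 0"
proof -
  have "continuous_on S (\<lambda>z. max (f z) (g z))"
    using cont by (intro continuous_intros)
  then obtain x where x: "x \<in> S" "\<And>y. y \<in> S \<Longrightarrow> max (f y) (g y) \<le> max (f x) (g x)"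
    using continuous_attains_sup[OF S, of "\<lambda>z. max (f z) (g z)"] z by blast
  have "max (f x) (g x) \<le> 0"
  proof (rule ccontr)
    assume "\<not> ?thesis"
    then consider "0 < f x" "g x \<le> f x" | "0 < g x" "f x \<le> g x" by linarith
    then show False
    proof cases
      case 1
      then obtain w where "w \<in> S" "f x < f w" using f x by blast
      then show False using x(2)[of w] 1 by linarith
    next
      case 2
      then obtain w where "w \<in> S" "g x < g w" using g x by blast
      then show False using x(2)[of w] 2 by linarith
    qed
  qed
  with x(2)[OF z] show ?thesis by linarith
qed

lemma interval_pair_max_principle:
  fixes f g :: "real \<Rightarrow> real"
  assumes cont: "continuous_on {c..d} f" "continuous_on {c..d} g"
    and der: "has_deriv2_on f f2 {c<..<d}" "has_deriv2_on g g2 {c<..<d}"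
    and bd: "f c \<le> 0" "g c \<le> 0" "f d \<le> 0" "g d \<le> 0"
    and f: "\<And>t. c < t \<Longrightarrow> t < d \<Longrightarrow> 0 < f t \<Longrightarrow> g t \<le> f t \<Longrightarrow> 0 < f2 t"
    and g: "\<And>t. c < t \<Longrightarrow> t < d \<Longrightarrow> 0 < g t \<Longrightarrow> f t \<le> g t \<Longrightarrow> 0 < g2 t"
    and t: "t \<in> {c..d}"
  shows "f t \<le> 0 \<and> g t \<le> 0"
proof -
  have *: "\<exists>w\<in>{c..d}. h s < h w"
    if h: "has_deriv2_on h h2 {c<..<d}" "h c \<le> 0" "h d \<le> 0" and s: "s \<in> {c..d}" "0 < h s"
      and pos: "c < s \<Longrightarrow> s < d \<Longrightarrow> 0 < h2 s" for h h2 s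
  proof -
    have s': "c < s" "s < d" using s h(2,3) by (auto simp: less_le)
    obtain w where w: "\<bar>w - s\<bar> < min (s - c) (d - s)" "h s < h w"
      using deriv2_pos_not_local_max[OF h(1), of s "min (s - c) (d - s)"] s' pos by auto
    then have "w \<in> {c..d}" by auto
    with w show ?thesis by blast
  qed
  show ?thesis
    by (rule compact_pair_max_principle[OF compact_Icc cont _ _ t])
      (use * der bd f g in auto)
qed

lemma interval_max_principle:
  fixes f :: "real \<Rightarrow> real"
  assumes "continuous_on {c..d} f" "has_deriv2_on f f2 {c<..<d}" "f c \<le> 0" "f d \<le> 0"
    and "\<And>t. c < t \<Longrightarrow> t < d \<Longrightarrow> 0 < f t \<Longrightarrow> 0 < f2 t" "t \<in> {c..d}"
  shows "f t \<le> 0"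
  using interval_pair_max_principle[OF assms(1,1,2,2), of t] assms by blast

section \<open>Linear two-point problems and pointwise limits under a bound on second
  derivatives\<close>

lemma integral_has_real_derivative_at:
  fixes h :: "real \<Rightarrow> real"
  assumes "continuous_on {c..d} h" "t \<in> {c<..<d}"
  shows "((\<lambda>x. integral {c..x} h) has_real_derivative h t) (at t)"
  using integral_has_real_derivative[OF assms(1), of t] assms(2)
  by (simp add: at_within_Icc_at)

text \<open>Variation of constants gives a particular solution \<open>p\<close> vanishing at
  \<open>c\<close>; the boundary values are then matched with the homogeneous solutions
  \<open>cosh\<close> and \<open>sinh\<close>.\<close>

lemma linear_bvp_solvable:
  fixes h :: "real \<Rightarrow> real"
  assumes k: "0 < k" and cd: "c < d" and h: "continuous_on {c..d} h"
  shows "\<exists>w. continuous_on {c..d} w \<and> has_deriv2_on w (\<lambda>t. k\<^sup>2 * w t + h t) {c<..<d} \<and>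
           w c = A \<and> w d = B"
proof -
  define I1 where "I1 t = integral {c..t} (\<lambda>s. exp (- k * s) * h s)" for t
  define I2 where "I2 t = integral {c..t} (\<lambda>s. exp (k * s) * h s)" for t
  have ch: "continuous_on {c..d} (\<lambda>s. exp (- k * s) * h s)" "continuous_on {c..d} (\<lambda>s. exp (k * s) * h s)"
    using h by (auto intro!: continuous_intros)
  have c1: "continuous_on {c..d} I1" "continuous_on {c..d} I2"
    unfolding I1_def I2_def using ch
    by (auto intro!: indefinite_integral_continuous_1 integrable_continuous_real)
  have d1: "(I1 has_real_derivative exp (- k * t) * h t) (at t)"
    "(I2 has_real_derivative exp (k * t) * h t) (at t)" if "t \<in> {c<..<d}" for t
    unfolding I1_def I2_def using integral_has_real_derivative_at[OF ch(1) that]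
      integral_has_real_derivative_at[OF ch(2) that] by auto
  \<comment> \<open>This is the integral of \<open>sinh (k * (t - s)) / k * h s\<close> over
    \<open>s\<close> from \<open>c\<close> to \<open>t\<close>, expanded so that each integral
    depends on \<open>t\<close> only through its upper limit.\<close>
  define p where "p t = (exp (k * t) * I1 t - exp (- k * t) * I2 t) / (2 * k)" for t
  define p1 where "p1 t = (exp (k * t) * I1 t + exp (- k * t) * I2 t) / 2" for t
  have e: "exp (k * t) * (exp (- k * t) * y) = y" "exp (- k * t) * (exp (k * t) * y) = y" for t y
    by (simp_all add: exp_minus)
  have E1: "((\<lambda>t. exp (k * t) * I1 t) has_real_derivative k * (exp (k * t) * I1 t) + h t) (at t)"
    if "t \<in> {c<..<d}" for t
  proof -
    have "((\<lambda>t. exp (k * t) * I1 t) has_real_derivative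
        exp (k * t) * k * I1 t + exp (- k * t) * h t * exp (k * t)) (at t)"
      by (intro DERIV_mult d1[OF that]) (auto intro!: derivative_eq_intros)
    then show ?thesis using e(1)[of t "h t"] by (simp only: mult.commute mult.left_commute)
  qed
  have E2: "((\<lambda>t. exp (- k * t) * I2 t) has_real_derivative - k * (exp (- k * t) * I2 t) + h t) (at t)"
    if "t \<in> {c<..<d}" for t
  proof -
    have "((\<lambda>t. exp (- k * t) * I2 t) has_real_derivative
        exp (- k * t) * (- k) * I2 t + exp (k * t) * h t * exp (- k * t)) (at t)"
      by (intro DERIV_mult d1[OF that]) (auto intro!: derivative_eq_intros)
    then show ?thesis using e(2)[of t "h t"] by (simp only: mult.commute mult.left_commute)
  qed
  have p: "(p has_real_derivative p1 t) (at t)" if "t \<in> {c<..<d}" for t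
  proof -
    have "(p has_real_derivative
        (k * (exp (k * t) * I1 t) + h t - (- k * (exp (- k * t) * I2 t) + h t)) / (2 * k)) (at t)"
      unfolding p_def by (intro DERIV_cdivide DERIV_diff E1[OF that] E2[OF that])
    moreover have "(k * (exp (k * t) * I1 t) + h t - (- k * (exp (- k * t) * I2 t) + h t)) / (2 * k) = p1 t"
      using k by (simp add: p1_def add_divide_distrib)
    ultimately show ?thesis by simp
  qed
  have p1: "(p1 has_real_derivative k\<^sup>2 * p t + h t) (at t)" if "t \<in> {c<..<d}" for t
  proof -
    have "(p1 has_real_derivative
        (k * (exp (k * t) * I1 t) + h t + (- k * (exp (- k * t) * I2 t) + h t)) / 2) (at t)"
      unfolding p1_def by (intro DERIV_cdivide DERIV_add E1[OF that] E2[OF that])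
    moreover have "(k * (exp (k * t) * I1 t) + h t + (- k * (exp (- k * t) * I2 t) + h t)) / 2 = k\<^sup>2 * p t + h t"
      using k by (simp add: p_def power2_eq_square add_divide_distrib diff_divide_distrib right_diff_distrib)
    ultimately show ?thesis by (simp only:)
  qed
  \<comment> \<open>Solves \<open>w d = B\<close> for the coefficient of \<open>sinh\<close>, which
    is nonzero at \<open>d\<close>; the coefficient of \<open>cosh\<close> is already fixed by
    \<open>w c = A\<close>.\<close>
  define \<beta> where "\<beta> = (B - A * cosh (k * (d - c)) - p d) / sinh (k * (d - c))"
  define w where "w t = A * cosh (k * (t - c)) + \<beta> * sinh (k * (t - c)) + p t" for t
  have "p c = 0" by (simp add: p_def I1_def I2_def)
  have "sinh (k * (d - c)) \<noteq> 0" using k cd by simp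
  have "continuous_on {c..d} w"
    unfolding w_def p_def by (intro continuous_intros c1) (use k in auto)
  moreover have "has_deriv2_on w (\<lambda>t. k\<^sup>2 * w t + h t) {c<..<d}"
  proof (rule has_deriv2_onI)
    have ch: "((\<lambda>t. A * cosh (k * (t - c)) + \<beta> * sinh (k * (t - c))) has_real_derivative
        k * (A * sinh (k * (t - c)) + \<beta> * cosh (k * (t - c)))) (at t)" for A \<beta> t
      by (auto intro!: derivative_eq_intros simp: algebra_simps)
    show "(w has_real_derivative k * (A * sinh (k * (t - c)) + \<beta> * cosh (k * (t - c))) + p1 t) (at t)"
      if "t \<in> {c<..<d}" for t
      unfolding w_def by (intro DERIV_add ch p[OF that])
    show "((\<lambda>t. k * (A * sinh (k * (t - c)) + \<beta> * cosh (k * (t - c))) + p1 t)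
        has_real_derivative k\<^sup>2 * w t + h t) (at t)" if "t \<in> {c<..<d}" for t
    proof -
      have "((\<lambda>t. k * (\<beta> * cosh (k * (t - c)) + A * sinh (k * (t - c))) + p1 t) has_real_derivative
          k * (k * (\<beta> * sinh (k * (t - c)) + A * cosh (k * (t - c)))) + (k\<^sup>2 * p t + h t)) (at t)"
        by (intro DERIV_add DERIV_cmult ch p1[OF that])
      then show ?thesis by (simp add: w_def algebra_simps power2_eq_square)
    qed
  qed
  moreover have "w c = A" using \<open>p c = 0\<close> by (simp add: w_def)
  moreover have "w d = B" using \<open>sinh _ \<noteq> 0\<close> by (simp add: w_def \<beta>_def)
  ultimately show ?thesis by blast
qed

text \<open>\<open>f - J\<close> has zero second derivative, hence is affine and determined by its
  end values. The formula contains no derivative of \<open>f\<close>, so it survives pointwise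
  limits.\<close>

lemma deriv2_integral_representation:
  fixes f h :: "real \<Rightarrow> real"
  assumes cd: "c < d" and f: "continuous_on {c..d} f" and h: "continuous_on {c..d} h"
    and der: "has_deriv2_on f h {c<..<d}" and t: "t \<in> {c..d}"
  defines "J \<equiv> \<lambda>t. integral {c..t} (\<lambda>s. integral {c..s} h)"
  shows "f t = f c + (t - c) / (d - c) * (f d - f c - J d) + J t"
proof -
  obtain f1 where f1: "\<forall>t\<in>{c<..<d}. (f has_real_derivative f1 t) (at t) \<and> (f1 has_real_derivative h t) (at t)"
    using der unfolding has_deriv2_on_def by blast
  define H where "H = (\<lambda>s. integral {c..s} h)"
  have H: "continuous_on {c..d} H" unfolding H_def
    using h by (auto intro!: indefinite_integral_continuous_1 integrable_continuous_real)
  have J: "continuous_on {c..d} J" unfolding J_def H_def[symmetric]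
    using H by (auto intro!: indefinite_integral_continuous_1 integrable_continuous_real)
  have dH: "(H has_real_derivative h t) (at t)" if "t \<in> {c<..<d}" for t
    unfolding H_def using integral_has_real_derivative_at[OF h that] .
  have dJ: "(J has_real_derivative H t) (at t)" if "t \<in> {c<..<d}" for t
    unfolding J_def H_def[symmetric] using integral_has_real_derivative_at[OF H that] .
  define k where "k = f1 ((c + d) / 2) - H ((c + d) / 2)"
  have k: "f1 t - H t = k" if "t \<in> {c<..<d}" for t
    unfolding k_def
  proof (rule DERIV_isconst3[OF cd that, of _ "\<lambda>t. f1 t - H t"])
    show "(c + d) / 2 \<in> {c<..<d}" using cd by simp
    show "DERIV (\<lambda>t. f1 t - H t) x :> 0" if "x \<in> {c<..<d}" for x
      using DERIV_diff[of f1 "h x" x UNIV H "h x"] dH[OF that] f1 that by simp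
  qed
  define w where "w = (\<lambda>t. f t - J t - k * (t - c))"
  have w: "w x = w c" if "x \<in> {c..d}" for x
  proof (rule DERIV_isconst2[OF cd])
    show "continuous_on {c..d} w" unfolding w_def by (intro continuous_intros f J)
    show "DERIV w x :> 0" if x: "c < x" "x < d" for x
    proof -
      have "(w has_real_derivative f1 x - H x - k * (1 - 0)) (at x)"
        unfolding w_def using f1 x
        by (intro DERIV_diff DERIV_cmult dJ DERIV_ident DERIV_const) auto
      with k[of x] x show ?thesis by simp
    qed
  qed (use that in auto)
  have "J c = 0" by (simp add: J_def)
  have *: "f x = f c + k * (x - c) + J x" if "x \<in> {c..d}" for x
    using w[OF that] \<open>J c = 0\<close> by (simp add: w_def)
  have "k = (f d - f c - J d) / (d - c)"
    using *[of d] cd by (simp add: field_simps)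
  with *[OF t] show ?thesis by (simp add: mult.commute)
qed

text \<open>Dominated convergence, applied to both nested integrals of the representation formula,
  carries it over to the limit. Continuity of \<open>F\<close> comes out before anything is known
  about continuity of \<open>G\<close>. This order matters: in the applications \<open>G\<close> is
  an expression in the limit functions, and its continuity follows from theirs.\<close>

lemma deriv2_limit:
  fixes f h :: "nat \<Rightarrow> real \<Rightarrow> real"
  assumes cd: "c < d" and f: "\<And>n. continuous_on {c..d} (f n)" and h: "\<And>n. continuous_on {c..d} (h n)"
    and der: "\<And>n. has_deriv2_on (f n) (h n) {c<..<d}"
    and bound: "\<And>n t. t \<in> {c..d} \<Longrightarrow> \<bar>h n t\<bar> \<le> B"
    and f_lim: "\<And>t. t \<in> {c..d} \<Longrightarrow> (\<lambda>n. f n t) \<longlonglongrightarrow> F t"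
    and h_lim: "\<And>t. t \<in> {c..d} \<Longrightarrow> (\<lambda>n. h n t) \<longlonglongrightarrow> G t"
  shows "continuous_on {c..d} F" and "continuous_on {c..d} G \<Longrightarrow> has_deriv2_on F G {c<..<d}"
proof -
  define H where "H = (\<lambda>n s. integral {c..s} (h n))"
  define K where "K = (\<lambda>s. integral {c..s} G)"
  define J where "J = (\<lambda>n t. integral {c..t} (H n))"
  define L where "L = (\<lambda>t. integral {c..t} K)"
  have sub: "{c..t} \<subseteq> {c..d}" if "t \<in> {c..d}" for t using that by auto
  have h_int: "h n integrable_on {c..t}" if "t \<in> {c..d}" for n t
    using h sub[OF that] by (meson continuous_on_subset integrable_continuous_real)
  have G_int: "G integrable_on {c..t}" and H_lim: "(\<lambda>n. H n t) \<longlonglongrightarrow> K t" if t: "t \<in> {c..d}" for t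
  proof -
    have *: "norm (h n x) \<le> B" "(\<lambda>n. h n x) \<longlonglongrightarrow> G x" if "x \<in> {c..t}" for n x
      using bound h_lim subsetD[OF sub[OF t] that] by simp_all
    show "G integrable_on {c..t}" "(\<lambda>n. H n t) \<longlonglongrightarrow> K t"
      unfolding H_def K_def
      by (rule dominated_convergence[of h "{c..t}" "\<lambda>_. B" G], rule h_int[OF t],
          rule integrable_const_ivl, erule *, erule *)+
  qed
  have H: "continuous_on {c..d} (H n)" for n unfolding H_def
    using h by (auto intro!: indefinite_integral_continuous_1 integrable_continuous_real)
  have K: "continuous_on {c..d} K" unfolding K_def
    using G_int[of d] cd by (auto intro!: indefinite_integral_continuous_1)
  have H_bound: "\<bar>H n t\<bar> \<le> B * (d - c)" if t: "t \<in> {c..d}" for n t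
  proof -
    have "B \<ge> 0" using bound[of c 0] cd by auto
    have "norm (integral {c..t} (h n)) \<le> B * (t - c)"
      using integral_bound[of c t "h n" B] t bound continuous_on_subset[OF h sub[OF t]] by auto
    also have "\<dots> \<le> B * (d - c)" using \<open>B \<ge> 0\<close> t by (auto intro: mult_left_mono)
    finally show ?thesis by (simp add: H_def)
  qed
  have H_int: "H n integrable_on {c..t}" if "t \<in> {c..d}" for n t
    using H sub[OF that] by (meson continuous_on_subset integrable_continuous_real)
  have J_lim: "(\<lambda>n. J n t) \<longlonglongrightarrow> L t" if t: "t \<in> {c..d}" for t
  proof -
    have *: "norm (H n x) \<le> B * (d - c)" "(\<lambda>n. H n x) \<longlonglongrightarrow> K x" if "x \<in> {c..t}" for n x
      using H_bound H_lim subsetD[OF sub[OF t] that] by simp_all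
    show ?thesis
      unfolding J_def L_def
      by (rule dominated_convergence[of H "{c..t}" "\<lambda>_. B * (d - c)" K], rule H_int[OF t],
          rule integrable_const_ivl, erule *, erule *)
  qed
  have repr: "f n t = f n c + (t - c) / (d - c) * (f n d - f n c - J n d) + J n t"
    if "t \<in> {c..d}" for n t
    using deriv2_integral_representation[OF cd f h der that] by (simp add: J_def H_def)
  have F: "F t = F c + (t - c) / (d - c) * (F d - F c - L d) + L t" if t: "t \<in> {c..d}" for t
  proof (rule LIMSEQ_unique[OF f_lim[OF t]])
    have "(\<lambda>n. f n c + (t - c) / (d - c) * (f n d - f n c - J n d) + J n t) \<longlonglongrightarrow>
        F c + (t - c) / (d - c) * (F d - F c - L d) + L t"
      using cd t by (intro tendsto_intros f_lim J_lim) auto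
    then show "(\<lambda>n. f n t) \<longlonglongrightarrow> F c + (t - c) / (d - c) * (F d - F c - L d) + L t"
      using repr[OF t] by simp
  qed
  define m where "m = (F d - F c - L d) / (d - c)"
  have F': "F t = F c + (t - c) * m + L t" if "t \<in> {c..d}" for t
    using F[OF that] by (simp add: m_def)
  have L: "continuous_on {c..d} L" unfolding L_def
    using K by (auto intro!: indefinite_integral_continuous_1 integrable_continuous_real)
  have "continuous_on {c..d} (\<lambda>t. F c + (t - c) * m + L t)"
    by (intro continuous_intros L)
  then show "continuous_on {c..d} F"
    by (rule continuous_on_eq) (rule F'[symmetric])
  assume G: "continuous_on {c..d} G"
  show "has_deriv2_on F G {c<..<d}"
  proof (rule has_deriv2_onI)
    show "(F has_real_derivative m + K t) (at t)" if t: "t \<in> {c<..<d}" for t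
    proof -
      have "((\<lambda>t. F c + (t - c) * m + L t) has_real_derivative m + K t) (at t)"
        using integral_has_real_derivative_at[OF K t] unfolding L_def
        by (auto intro!: derivative_eq_intros)
      moreover have "\<forall>\<^sub>F s in nhds t. F s = F c + (s - c) * m + L s"
        by (rule eventually_mono[OF eventually_nhds_in_open[of "{c<..<d}"]], simp, rule t, rule F') simp
      ultimately show ?thesis
        using DERIV_cong_ev[OF refl _ refl, THEN iffD2] by fast
    qed
    show "((\<lambda>t. m + K t) has_real_derivative G t) (at t)" if t: "t \<in> {c<..<d}" for t
      using integral_has_real_derivative_at[OF G t]
      by (auto simp: K_def intro!: derivative_eq_intros)
  qed
qed

section \<open>The radial system on a bounded interval\<close>

text \<open>The factor combines the 4 in \<open>d_z_zbar\<close> with |z|^2 = exp(2t), by which the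
  Laplacian is multiplied in the variable t = ln |z|. At t = 0 it is just 4, so
  \<open>rhs1 a 0\<close> also expresses the Laplacian at any point of the plane.\<close>

definition rhs1 :: "real \<Rightarrow> real \<Rightarrow> real \<Rightarrow> real \<Rightarrow> real" where
  "rhs1 a t x y = 4 * exp (2 * t) * (exp (a * x) - exp (y - x))"

definition rhs2 :: "real \<Rightarrow> real \<Rightarrow> real \<Rightarrow> real \<Rightarrow> real" where
  "rhs2 b t x y = 4 * exp (2 * t) * (exp (y - x) - exp (- b * y))"

definition ode_solution where
  "ode_solution a b u v I \<longleftrightarrow>
     has_deriv2_on u (\<lambda>t. rhs1 a t (u t) (v t)) I \<and> has_deriv2_on v (\<lambda>t. rhs2 b t (u t) (v t)) I"

definition ode_supersolution where
  "ode_supersolution a b u v I \<longleftrightarrow>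
     (\<exists>u2 v2. has_deriv2_on u u2 I \<and> has_deriv2_on v v2 I \<and>
        (\<forall>t\<in>I. u2 t \<le> rhs1 a t (u t) (v t) \<and> v2 t \<le> rhs2 b t (u t) (v t)))"

text \<open>The reflection symmetry of the system at the level of the right-hand sides; it reduces
  each estimate on \<open>rhs2\<close> to the one on \<open>rhs1\<close>.\<close>

lemma rhs2_eq: "rhs2 b t x y = - rhs1 b t (- y) (- x)"
  by (simp add: rhs1_def rhs2_def right_diff_distrib)

lemma rhs1_eq: "rhs1 a t x y = - rhs2 a t (- y) (- x)"
  by (simp add: rhs2_eq)

text \<open>The hypotheses describe the point where the larger of the two differences is maximal and
  positive: there the coupling \<open>exp (y - x)\<close> does not increase, while
  \<open>exp (a * x)\<close> increases strictly.\<close>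

lemma rhs1_strict_mono:
  assumes "0 < a" "x' < x" "y - y' \<le> x - x'"
  shows "rhs1 a t x' y' < rhs1 a t x y"
proof -
  have "exp (a * x') < exp (a * x)" "exp (y - x) \<le> exp (y' - x')" using assms by auto
  then have "exp (a * x') - exp (y' - x') < exp (a * x) - exp (y - x)" by linarith
  then show ?thesis unfolding rhs1_def by (rule mult_strict_left_mono) simp
qed

lemma rhs2_strict_mono:
  assumes "0 < b" "y' < y" "x - x' \<le> y - y'"
  shows "rhs2 b t x' y' < rhs2 b t x y"
  using rhs1_strict_mono[of b "- y" "- y'" "- x'" "- x" t] assms by (simp add: rhs2_eq)

text \<open>On the box of size \<open>C\<close> the partial derivative of \<open>rhs1\<close> in
  \<open>x\<close> is at most \<open>K\<close>, so subtracting \<open>K * x\<close> makes the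
  expression decreasing in \<open>x\<close>; increasing \<open>y\<close> only lowers it. The
  monotone iteration rests on this.\<close>

lemma rhs1_quasi_antimono:
  assumes "0 < a" "x \<le> x'" "y \<le> y'" "\<bar>x\<bar> \<le> C" "\<bar>x'\<bar> \<le> C" "\<bar>y\<bar> \<le> C" "t \<le> d"
    and K: "4 * exp (2 * d) * (a * exp (a * C) + exp (2 * C)) \<le> K"
  shows "rhs1 a t x' y' - K * x' \<le> rhs1 a t x y - K * x"
proof -
  \<comment> \<open>The tangent inequality for \<open>exp\<close> at \<open>p\<close>, which
    replaces the mean value theorem.\<close>
  have ex: "exp p - exp q \<le> (p - q) * exp r" if "q \<le> p" "p \<le> r" for p q r :: real
  proof -
    have "exp q = exp p * exp (q - p)" by (simp add: mult_exp_exp)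
    moreover have "exp p * (1 + (q - p)) \<le> exp p * exp (q - p)"
      by (intro mult_left_mono exp_ge_add_one_self) auto
    ultimately have "exp p - exp q \<le> (p - q) * exp p" by (simp add: algebra_simps)
    also have "\<dots> \<le> (p - q) * exp r" using that by (intro mult_left_mono) auto
    finally show ?thesis .
  qed
  have "exp (a * x') - exp (a * x) \<le> (a * x' - a * x) * exp (a * C)"
    using assms by (intro ex mult_left_mono) auto
  moreover have "exp (y - x) - exp (y - x') \<le> ((y - x) - (y - x')) * exp (2 * C)"
    using assms by (intro ex) auto
  moreover have "exp (y - x') \<le> exp (y' - x')" using assms by simp
  moreover have "(x' - x) * (a * exp (a * C) + exp (2 * C)) =
      (a * x' - a * x) * exp (a * C) + ((y - x) - (y - x')) * exp (2 * C)"
    by (simp add: algebra_simps)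
  ultimately have "(exp (a * x') - exp (y' - x')) - (exp (a * x) - exp (y - x))
      \<le> (x' - x) * (a * exp (a * C) + exp (2 * C))"
    by linarith
  then have "4 * exp (2 * t) * ((exp (a * x') - exp (y' - x')) - (exp (a * x) - exp (y - x)))
      \<le> 4 * exp (2 * t) * ((x' - x) * (a * exp (a * C) + exp (2 * C)))"
    by (intro mult_left_mono) auto
  also have "\<dots> \<le> 4 * exp (2 * d) * ((x' - x) * (a * exp (a * C) + exp (2 * C)))"
    using assms by (intro mult_right_mono) (auto intro!: mult_nonneg_nonneg add_nonneg_nonneg)
  also have "\<dots> = (4 * exp (2 * d) * (a * exp (a * C) + exp (2 * C))) * (x' - x)" by simp
  also have "\<dots> \<le> K * (x' - x)" using assms by (intro mult_right_mono) auto
  finally show ?thesis by (simp add: rhs1_def algebra_simps)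
qed

lemma rhs2_quasi_antimono:
  assumes "0 < b" "x \<le> x'" "y \<le> y'" "\<bar>y\<bar> \<le> C" "\<bar>y'\<bar> \<le> C" "\<bar>x'\<bar> \<le> C" "t \<le> d"
    and "4 * exp (2 * d) * (b * exp (b * C) + exp (2 * C)) \<le> K"
  shows "rhs2 b t x' y' - K * y' \<le> rhs2 b t x y - K * y"
  using rhs1_quasi_antimono[of b "- y'" "- y" "- x'" "- x" C t d K] assms by (simp add: rhs2_eq)

lemma abs_rhs1_le:
  assumes "0 < a" "\<bar>x\<bar> \<le> C" "\<bar>y\<bar> \<le> C" "t \<le> d"
  shows "\<bar>rhs1 a t x y\<bar> \<le> 4 * exp (2 * d) * (exp (a * C) + exp (2 * C))"
proof -
  have "exp (a * x) \<le> exp (a * C)" "exp (y - x) \<le> exp (2 * C)" using assms by auto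
  then have "\<bar>exp (a * x) - exp (y - x)\<bar> \<le> exp (a * C) + exp (2 * C)"
    by (smt (verit) exp_gt_zero)
  then show ?thesis
    unfolding rhs1_def abs_mult using assms by (intro mult_mono) auto
qed

lemma abs_rhs2_le:
  assumes "0 < b" "\<bar>x\<bar> \<le> C" "\<bar>y\<bar> \<le> C" "t \<le> d"
  shows "\<bar>rhs2 b t x y\<bar> \<le> 4 * exp (2 * d) * (exp (b * C) + exp (2 * C))"
  using abs_rhs1_le[of b "- y" C "- x" t d] assms by (simp add: rhs2_eq)

lemma continuous_on_rhs [continuous_intros]:
  assumes "continuous_on S u" "continuous_on S v"
  shows "continuous_on S (\<lambda>t. rhs1 a t (u t) (v t))" "continuous_on S (\<lambda>t. rhs2 b t (u t) (v t))"
  unfolding rhs1_def rhs2_def using assms by (auto intro!: continuous_intros)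

lemma ode_solution_subset: "ode_solution a b u v I \<Longrightarrow> J \<subseteq> I \<Longrightarrow> ode_solution a b u v J"
  unfolding ode_solution_def using has_deriv2_on_subset by blast

lemma ode_supersolution_subset:
  "ode_supersolution a b u v I \<Longrightarrow> J \<subseteq> I \<Longrightarrow> ode_supersolution a b u v J"
  unfolding ode_supersolution_def by (meson has_deriv2_on_subset subsetD)

lemma ode_solution_reflect:
  assumes "ode_solution a b u v I"
  shows "ode_solution b a (\<lambda>t. - v t) (\<lambda>t. - u t) I"
  using assms has_deriv2_on_minus[of u _ I] has_deriv2_on_minus[of v _ I]
  unfolding ode_solution_def
  by (auto elim!: has_deriv2_on_cong[OF has_deriv2_on_minus] simp: rhs1_eq[of a] rhs2_eq[of b])

section \<open>Comparison and monotone iteration\<close>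

lemma ode_comparison:
  assumes ab: "0 < a" "0 < b"
    and sol: "ode_solution a b u v {c<..<d}" and super: "ode_supersolution a b U V {c<..<d}"
    and cont: "continuous_on {c..d} u" "continuous_on {c..d} v" "continuous_on {c..d} U" "continuous_on {c..d} V"
    and bd: "u c \<le> U c" "v c \<le> V c" "u d \<le> U d" "v d \<le> V d" and t: "t \<in> {c..d}"
  shows "u t \<le> U t \<and> v t \<le> V t"
proof -
  obtain U2 V2 where U2: "has_deriv2_on U U2 {c<..<d}" and V2: "has_deriv2_on V V2 {c<..<d}"
    and le: "\<And>t. t \<in> {c<..<d} \<Longrightarrow> U2 t \<le> rhs1 a t (U t) (V t)"
      "\<And>t. t \<in> {c<..<d} \<Longrightarrow> V2 t \<le> rhs2 b t (U t) (V t)"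
    using super unfolding ode_supersolution_def by blast
  have "u t - U t \<le> 0 \<and> v t - V t \<le> 0"
  proof (rule interval_pair_max_principle[where c = c and d = d and t = t
        and f = "\<lambda>t. u t - U t" and g = "\<lambda>t. v t - V t"])
    show "has_deriv2_on (\<lambda>t. u t - U t) (\<lambda>t. rhs1 a t (u t) (v t) - U2 t) {c<..<d}"
      "has_deriv2_on (\<lambda>t. v t - V t) (\<lambda>t. rhs2 b t (u t) (v t) - V2 t) {c<..<d}"
      using sol U2 V2 unfolding ode_solution_def by (auto intro: has_deriv2_on_diff)
    show "0 < rhs1 a t (u t) (v t) - U2 t"
      if "c < t" "t < d" "0 < u t - U t" "v t - V t \<le> u t - U t" for t
      using rhs1_strict_mono[OF ab(1), of "U t" "u t" "v t" "V t" t] le(1)[of t] that by simp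
    show "0 < rhs2 b t (u t) (v t) - V2 t"
      if "c < t" "t < d" "0 < v t - V t" "u t - U t \<le> v t - V t" for t
      using rhs2_strict_mono[OF ab(2), of "V t" "v t" "u t" "U t" t] le(2)[of t] that by simp
  qed (use cont bd t in \<open>auto intro!: continuous_intros\<close>)
  then show ?thesis by simp
qed

text \<open>An iteration step decouples into scalar linear problems, and for these a larger source
  gives a smaller solution. Together with the antimonotone right-hand sides this makes the iteration
  order preserving.\<close>

lemma linear_comparison:
  assumes K: "0 < K" and cont: "continuous_on {c..d} f" "continuous_on {c..d} g"
    and f: "has_deriv2_on f (\<lambda>t. K * f t + p t) {c<..<d}"
    and g: "has_deriv2_on g (\<lambda>t. K * g t + q t) {c<..<d}"
    and bd: "f c \<le> g c" "f d \<le> g d" and le: "\<And>t. t \<in> {c..d} \<Longrightarrow> q t \<le> p t"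
    and t: "t \<in> {c..d}"
  shows "f t \<le> g t"
proof -
  have "f t - g t \<le> 0"
  proof (rule interval_max_principle[where c = c and d = d and t = t and f = "\<lambda>t. f t - g t"])
    show "has_deriv2_on (\<lambda>t. f t - g t) (\<lambda>t. (K * f t + p t) - (K * g t + q t)) {c<..<d}"
      using f g by (rule has_deriv2_on_diff)
    show "0 < (K * f t + p t) - (K * g t + q t)" if "c < t" "t < d" "0 < f t - g t" for t
      using mult_strict_left_mono[OF _ K, of "g t" "f t"] le[of t] that by simp
  qed (use cont bd t in \<open>auto intro!: continuous_intros\<close>)
  then show ?thesis by simp
qed

lemma ode_bvp_solvable:
  assumes ab: "0 < a" "0 < b" and cd: "c < d"
  shows "\<exists>u v. continuous_on {c..d} u \<and> continuous_on {c..d} v \<and> ode_solution a b u v {c<..<d} \<and>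
           u c = A1 \<and> v c = A2 \<and> u d = B1 \<and> v d = B2"
proof -
  \<comment> \<open>Any bound on the four boundary values would do. At \<open>(C, C)\<close> the
    coupling term is 1, so both right-hand sides are nonnegative, and at \<open>(- C, - C)\<close>
    they are nonpositive: the constants are a super- and a subsolution enclosing the boundary
    data.\<close>
  define C where "C = \<bar>A1\<bar> + \<bar>A2\<bar> + \<bar>B1\<bar> + \<bar>B2\<bar>"
  have C: "\<bar>A1\<bar> \<le> C" "\<bar>A2\<bar> \<le> C" "\<bar>B1\<bar> \<le> C" "\<bar>B2\<bar> \<le> C" "0 \<le> C" by (auto simp: C_def)
  define K where "K = 4 * exp (2 * d) * (a * exp (a * C) + b * exp (b * C) + exp (2 * C))"
  have K: "0 < K" "4 * exp (2 * d) * (a * exp (a * C) + exp (2 * C)) \<le> K"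
    "4 * exp (2 * d) * (b * exp (b * C) + exp (2 * C)) \<le> K"
    using ab unfolding K_def by (auto intro!: mult_left_mono mult_pos_pos add_pos_pos)
  define R1 where "R1 t x y = rhs1 a t x y - K * x" for t x y
  define R2 where "R2 t x y = rhs2 b t x y - K * y" for t x y
  \<comment> \<open>\<open>?Q p q\<close> says that \<open>q\<close> solves the linear problem whose
    nonlinear source is frozen at \<open>p\<close>; a fixed point of this step solves the system,
    since the terms with \<open>K\<close> cancel.\<close>
  let ?P = "\<lambda>p. continuous_on {c..d} (fst p) \<and> continuous_on {c..d} (snd p)"
  let ?Q = "\<lambda>p q. has_deriv2_on (fst q) (\<lambda>t. K * fst q t + R1 t (fst p t) (snd p t)) {c<..<d} \<and>
      has_deriv2_on (snd q) (\<lambda>t. K * snd q t + R2 t (fst p t) (snd p t)) {c<..<d} \<and>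
      fst q c = A1 \<and> snd q c = A2 \<and> fst q d = B1 \<and> snd q d = B2"
  have solve: "\<exists>w. continuous_on {c..d} w \<and> has_deriv2_on w (\<lambda>t. K * w t + h t) {c<..<d} \<and> w c = A \<and> w d = B"
    if "continuous_on {c..d} h" for h A B
    using linear_bvp_solvable[of "sqrt K" c d h A B] K(1) cd that by simp
  have step: "\<exists>q. ?P q \<and> ?Q p q" if p: "?P p" for p
  proof -
    have "continuous_on {c..d} (\<lambda>t. R1 t (fst p t) (snd p t))" "continuous_on {c..d} (\<lambda>t. R2 t (fst p t) (snd p t))"
      unfolding R1_def R2_def using p by (auto intro!: continuous_intros)
    from solve[OF this(1), of A1 B1] solve[OF this(2), of A2 B2]
    obtain w1 w2 where "?P (w1, w2) \<and> ?Q p (w1, w2)" by auto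
    then show ?thesis by blast
  qed
  define N where "N p = (SOME q. ?P q \<and> ?Q p q)" for p
  have N: "?P (N p) \<and> ?Q p (N p)" if "?P p" for p
    unfolding N_def by (rule someI_ex[OF step[OF that]])
  define f where "f n = (N ^^ n) (\<lambda>_. C, \<lambda>_. C)" for n
  have f0: "f 0 = (\<lambda>_. C, \<lambda>_. C)" and fS: "f (Suc n) = N (f n)" for n by (simp_all add: f_def)
  have fP: "?P (f n)" for n
  proof (induction n)
    case (Suc n)
    then show ?case unfolding fS using N by blast
  qed (simp add: f0)
  have f: "?P (f n) \<and> ?Q (f n) (f (Suc n))" for n
    unfolding fS using fP N by blast
  define u where "u n = fst (f n)" for n
  define v where "v n = snd (f n)" for n
  have u0: "u 0 = (\<lambda>_. C)" "v 0 = (\<lambda>_. C)" by (simp_all add: u_def v_def f0)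
  have cont: "continuous_on {c..d} (u n)" "continuous_on {c..d} (v n)" for n
    using f by (simp_all add: u_def v_def)
  have du: "has_deriv2_on (u (Suc n)) (\<lambda>t. K * u (Suc n) t + R1 t (u n t) (v n t)) {c<..<d}" for n
    using f by (simp add: u_def v_def)
  have dv: "has_deriv2_on (v (Suc n)) (\<lambda>t. K * v (Suc n) t + R2 t (u n t) (v n t)) {c<..<d}" for n
    using f by (simp add: u_def v_def)
  \<comment> \<open>Iterate 0 is the constant \<open>C\<close> and misses the boundary values, so
    these hold only from index 1 on; the limits below are therefore taken along the shifted
    sequence.\<close>
  have bd: "u (Suc n) c = A1" "v (Suc n) c = A2" "u (Suc n) d = B1" "v (Suc n) d = B2" for n
    using f by (simp_all add: u_def v_def)
  have R1_mono: "R1 t x' y' \<le> R1 t x y"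
    if "x \<le> x'" "y \<le> y'" "\<bar>x\<bar> \<le> C" "\<bar>x'\<bar> \<le> C" "\<bar>y\<bar> \<le> C" "t \<in> {c..d}" for t x x' y y'
    using rhs1_quasi_antimono[OF ab(1), of x x' y y' C t d K] K(2) that by (simp add: R1_def)
  have R2_mono: "R2 t x' y' \<le> R2 t x y"
    if "x \<le> x'" "y \<le> y'" "\<bar>y\<bar> \<le> C" "\<bar>y'\<bar> \<le> C" "\<bar>x'\<bar> \<le> C" "t \<in> {c..d}" for t x x' y y'
    using rhs2_quasi_antimono[OF ab(2), of x x' y y' C t d K] K(3) that by (simp add: R2_def)
  have const: "has_deriv2_on (\<lambda>_. B) (\<lambda>t. K * B + - (K * B)) {c<..<d}" for B
    using has_deriv2_on_affine[of B 0] by simp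
  have R_C: "- (K * C) \<le> R1 t C C" "- (K * C) \<le> R2 t C C" for t
    using ab C by (auto simp: R1_def R2_def rhs1_def rhs2_def)
  have R_mC: "R1 t (- C) (- C) \<le> K * C" "R2 t (- C) (- C) \<le> K * C" for t
    using ab C by (auto simp: R1_def R2_def rhs1_def rhs2_def mult_le_0_iff)
  have inv: "\<forall>t\<in>{c..d}. \<bar>u n t\<bar> \<le> C \<and> \<bar>v n t\<bar> \<le> C \<and> u (Suc n) t \<le> u n t \<and> v (Suc n) t \<le> v n t" for n
  proof -
    \<comment> \<open>The lower bound is carried along with monotonicity because the right-hand
      sides are antimonotone only inside the box.\<close>
    have low: "- C \<le> u (Suc n) t \<and> - C \<le> v (Suc n) t"
      if n: "\<And>t. t \<in> {c..d} \<Longrightarrow> \<bar>u n t\<bar> \<le> C \<and> \<bar>v n t\<bar> \<le> C" and t: "t \<in> {c..d}" for n t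
    proof -
      have "R1 t (u n t) (v n t) \<le> - (K * - C)" "R2 t (u n t) (v n t) \<le> - (K * - C)" if "t \<in> {c..d}" for t
      proof -
        have "\<bar>u n t\<bar> \<le> C" "\<bar>v n t\<bar> \<le> C" "\<bar>- C\<bar> \<le> C" "- C \<le> u n t" "- C \<le> v n t"
          using n[OF that] C(5) by linarith+
        then show "R1 t (u n t) (v n t) \<le> - (K * - C)" "R2 t (u n t) (v n t) \<le> - (K * - C)"
          using R1_mono[of "- C" "u n t" "- C" "v n t" t] R2_mono[of "- C" "u n t" "- C" "v n t" t]
            R_mC[of t] that by linarith+
      qed
      then show ?thesis
        using bd C by (intro conjI linear_comparison[OF K(1) continuous_on_const cont(1) const du _ _ _ t]
          linear_comparison[OF K(1) continuous_on_const cont(2) const dv _ _ _ t]) auto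
    qed
    have "\<forall>t\<in>{c..d}. \<bar>u n t\<bar> \<le> C \<and> \<bar>v n t\<bar> \<le> C \<and> \<bar>u (Suc n) t\<bar> \<le> C \<and> \<bar>v (Suc n) t\<bar> \<le> C \<and>
        u (Suc n) t \<le> u n t \<and> v (Suc n) t \<le> v n t"
    proof (induction n)
      case 0
      show ?case
      proof
        fix t assume t: "t \<in> {c..d}"
        have "u (Suc 0) t \<le> C" "v (Suc 0) t \<le> C"
          using bd C R_C by (intro linear_comparison[OF K(1) cont(1) continuous_on_const du const _ _ _ t]
            linear_comparison[OF K(1) cont(2) continuous_on_const dv const _ _ _ t]; simp add: u0 abs_le_iff)+
        moreover have "- C \<le> u (Suc 0) t \<and> - C \<le> v (Suc 0) t"
          using C by (intro low t) (simp add: u0)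
        ultimately show "\<bar>u 0 t\<bar> \<le> C \<and> \<bar>v 0 t\<bar> \<le> C \<and> \<bar>u (Suc 0) t\<bar> \<le> C \<and> \<bar>v (Suc 0) t\<bar> \<le> C \<and>
            u (Suc 0) t \<le> u 0 t \<and> v (Suc 0) t \<le> v 0 t"
          using C(5) unfolding u0 abs_le_iff by linarith
      qed
    next
      case (Suc n)
      show ?case
      proof
        fix t assume t: "t \<in> {c..d}"
        have "R1 t (u n t) (v n t) \<le> R1 t (u (Suc n) t) (v (Suc n) t)"
          "R2 t (u n t) (v n t) \<le> R2 t (u (Suc n) t) (v (Suc n) t)" if "t \<in> {c..d}" for t
          using bspec[OF Suc that] that by (intro R1_mono R2_mono; simp)+
        then have "u (Suc (Suc n)) t \<le> u (Suc n) t" "v (Suc (Suc n)) t \<le> v (Suc n) t"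
          using bd by (intro linear_comparison[OF K(1) cont(1) cont(1) du du _ _ _ t]
            linear_comparison[OF K(1) cont(2) cont(2) dv dv _ _ _ t]; simp)+
        moreover have "- C \<le> u (Suc (Suc n)) t \<and> - C \<le> v (Suc (Suc n)) t"
          using Suc by (intro low t) simp
        ultimately show "\<bar>u (Suc n) t\<bar> \<le> C \<and> \<bar>v (Suc n) t\<bar> \<le> C \<and>
            \<bar>u (Suc (Suc n)) t\<bar> \<le> C \<and> \<bar>v (Suc (Suc n)) t\<bar> \<le> C \<and>
            u (Suc (Suc n)) t \<le> u (Suc n) t \<and> v (Suc (Suc n)) t \<le> v (Suc n) t"
          using bspec[OF Suc t] unfolding abs_le_iff by linarith
      qed
    qed
    then show ?thesis by simp
  qed
  have uv_bound: "\<bar>u n t\<bar> \<le> C" "\<bar>v n t\<bar> \<le> C" if "t \<in> {c..d}" for n t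
    using bspec[OF inv that, of n] by simp_all
  have conv: "convergent x" if "\<And>n. x (Suc n) \<le> x n" "\<And>n. \<bar>x n\<bar> \<le> C" for x :: "nat \<Rightarrow> real"
  proof (rule Bseq_monoseq_convergent)
    show "Bseq x" using that(2) by (intro BseqI'[of _ C]) simp
    show "monoseq x" by (rule decseq_imp_monoseq, rule decseq_SucI, rule that(1))
  qed
  define U where "U t = lim (\<lambda>n. u n t)" for t
  define V where "V t = lim (\<lambda>n. v n t)" for t
  have U: "(\<lambda>n. u n t) \<longlonglongrightarrow> U t" and V: "(\<lambda>n. v n t) \<longlonglongrightarrow> V t" if t: "t \<in> {c..d}" for t
  proof -
    have "convergent (\<lambda>n. u n t)" "convergent (\<lambda>n. v n t)"
      by (rule conv; use bspec[OF inv t] in blast)+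
    then show "(\<lambda>n. u n t) \<longlonglongrightarrow> U t" "(\<lambda>n. v n t) \<longlonglongrightarrow> V t"
      unfolding U_def V_def convergent_LIMSEQ_iff .
  qed
  \<comment> \<open>A crude bound on all second derivatives, independent of \<open>n\<close>,
    serving as the integrable majorant.\<close>
  define B where "B = K * C + (4 * exp (2 * d) * (exp (a * C) + exp (b * C) + exp (2 * C)) + K * C)"
  have h_bound: "\<bar>K * u (Suc n) t + R1 t (u n t) (v n t)\<bar> \<le> B"
    "\<bar>K * v (Suc n) t + R2 t (u n t) (v n t)\<bar> \<le> B" if t: "t \<in> {c..d}" for n t
  proof -
    have Kw: "\<bar>K * w\<bar> \<le> K * C" if "\<bar>w\<bar> \<le> C" for w
      using that K(1) by (simp add: abs_mult)
    have "\<bar>rhs1 a t (u n t) (v n t)\<bar> \<le> 4 * exp (2 * d) * (exp (a * C) + exp (2 * C))"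
      "\<bar>rhs2 b t (u n t) (v n t)\<bar> \<le> 4 * exp (2 * d) * (exp (b * C) + exp (2 * C))"
      using ab t uv_bound[OF t] by (intro abs_rhs1_le abs_rhs2_le; simp)+
    moreover have "4 * exp (2 * d) * (exp (a * C) + exp (2 * C)) \<le> 4 * exp (2 * d) * (exp (a * C) + exp (b * C) + exp (2 * C))"
      "4 * exp (2 * d) * (exp (b * C) + exp (2 * C)) \<le> 4 * exp (2 * d) * (exp (a * C) + exp (b * C) + exp (2 * C))"
      by (auto intro!: mult_left_mono)
    ultimately show "\<bar>K * u (Suc n) t + R1 t (u n t) (v n t)\<bar> \<le> B"
      "\<bar>K * v (Suc n) t + R2 t (u n t) (v n t)\<bar> \<le> B"
      using Kw[OF uv_bound(1)[OF t, of n]] Kw[OF uv_bound(2)[OF t, of n]]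
        Kw[OF uv_bound(1)[OF t, of "Suc n"]] Kw[OF uv_bound(2)[OF t, of "Suc n"]]
      unfolding R1_def R2_def B_def by linarith+
  qed
  have lim_h: "(\<lambda>n. K * u (Suc n) t + R1 t (u n t) (v n t)) \<longlonglongrightarrow> K * U t + R1 t (U t) (V t)"
    "(\<lambda>n. K * v (Suc n) t + R2 t (u n t) (v n t)) \<longlonglongrightarrow> K * V t + R2 t (U t) (V t)"
    if t: "t \<in> {c..d}" for t
    unfolding R1_def R2_def rhs1_def rhs2_def
    by (intro tendsto_intros U[OF t] V[OF t] LIMSEQ_Suc)+
  have cont_h: "continuous_on {c..d} (\<lambda>t. K * u (Suc n) t + R1 t (u n t) (v n t))"
    "continuous_on {c..d} (\<lambda>t. K * v (Suc n) t + R2 t (u n t) (v n t))" for n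
    unfolding R1_def R2_def by (intro continuous_intros cont)+
  note limU = deriv2_limit[OF cd cont(1) cont_h(1) du h_bound(1) LIMSEQ_Suc[OF U] lim_h(1)]
  note limV = deriv2_limit[OF cd cont(2) cont_h(2) dv h_bound(2) LIMSEQ_Suc[OF V] lim_h(2)]
  have cUV: "continuous_on {c..d} U" "continuous_on {c..d} V"
    using limU(1) limV(1) by auto
  have "continuous_on {c..d} (\<lambda>t. K * U t + R1 t (U t) (V t))" "continuous_on {c..d} (\<lambda>t. K * V t + R2 t (U t) (V t))"
    unfolding R1_def R2_def by (intro continuous_intros cUV)+
  then have "ode_solution a b U V {c<..<d}"
    using limU(2) limV(2) by (simp add: ode_solution_def R1_def R2_def)
  moreover have "U c = A1" "V c = A2" "U d = B1" "V d = B2"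
    using LIMSEQ_unique[OF LIMSEQ_Suc[OF U[of c]], of A1] LIMSEQ_unique[OF LIMSEQ_Suc[OF V[of c]], of A2]
      LIMSEQ_unique[OF LIMSEQ_Suc[OF U[of d]], of B1] LIMSEQ_unique[OF LIMSEQ_Suc[OF V[of d]], of B2] cd
    by (simp_all add: bd)
  ultimately show ?thesis using cUV by blast
qed

section \<open>Barriers\<close>

definition bvp_solution where
  "bvp_solution a b \<gamma> \<delta> T u v \<longleftrightarrow>
     continuous_on {- T..T} u \<and> continuous_on {- T..T} v \<and> ode_solution a b u v {- T<..<T} \<and>
     u (- T) = - \<gamma> * T \<and> v (- T) = - \<delta> * T \<and> u T = 0 \<and> v T = 0"

lemma bvp_solution_reflect:
  "bvp_solution a b \<gamma> \<delta> T u v \<Longrightarrow> bvp_solution b a (- \<delta>) (- \<gamma>) T (\<lambda>t. - v t) (\<lambda>t. - u t)"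
  unfolding bvp_solution_def by (auto intro!: continuous_intros ode_solution_reflect)

text \<open>Adding the same nonnegative amount to both components leaves \<open>v - u\<close>
  unchanged, raises \<open>exp (a * u)\<close> and lowers \<open>exp (- b * v)\<close>; an affine
  amount does not affect the second derivatives.\<close>

lemma supersolution_shift:
  assumes ab: "0 < a" "0 < b" and sol: "ode_solution a b u v I" and nonneg: "\<And>t. t \<in> I \<Longrightarrow> 0 \<le> p + q * t"
  shows "ode_supersolution a b (\<lambda>t. u t + (p + q * t)) (\<lambda>t. v t + (p + q * t)) I"
proof -
  have "rhs1 a t (u t) (v t) \<le> rhs1 a t (u t + (p + q * t)) (v t + (p + q * t))"
    "rhs2 b t (u t) (v t) \<le> rhs2 b t (u t + (p + q * t)) (v t + (p + q * t))" if "t \<in> I" for t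
    unfolding rhs1_def rhs2_def using ab nonneg[OF that]
    by (auto intro!: mult_left_mono)
  moreover have "has_deriv2_on (\<lambda>t. u t + (p + q * t)) (\<lambda>t. rhs1 a t (u t) (v t) + 0) I"
    "has_deriv2_on (\<lambda>t. v t + (p + q * t)) (\<lambda>t. rhs2 b t (u t) (v t) + 0) I"
    using sol unfolding ode_solution_def by (intro has_deriv2_on_add has_deriv2_on_affine; simp)+
  ultimately show ?thesis
    unfolding ode_supersolution_def add_0_right by blast
qed

text \<open>With y = N exp(-2t), the choice of \<open>q\<close> gives
  \<open>exp (q * y - y) = exp (a * y / 2)\<close>, which lies between \<open>exp (a * y)\<close>
  and 1, so both equations have a gap of at least \<open>X = exp (a * y / 2) - 1\<close>. Since X is
  at least a^2 y^2 / 8 and exp(2t) y = N, the right-hand sides are at least N a^2 y / 2; the lower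
  bound on \<open>N\<close> makes this at least 4 q y, the larger of the two second
  derivatives.\<close>

lemma exponential_supersolution:
  assumes ab: "0 < a" "0 < b" and q: "q = 1 + a / 2" and N: "8 * q / a\<^sup>2 \<le> N"
  shows "ode_supersolution a b (\<lambda>t. N * exp (- 2 * t)) (\<lambda>t. q * N * exp (- 2 * t)) I"
proof -
  have "0 < 8 * q / a\<^sup>2" using ab q by simp
  then have N0: "0 < N" using N by linarith
  have der: "has_deriv2_on (\<lambda>t. M * exp (- 2 * t)) (\<lambda>t. 4 * (M * exp (- 2 * t))) I" for M
    by (rule has_deriv2_onI[where ?f1.0 = "\<lambda>t. - 2 * (M * exp (- 2 * t))"])
      (auto intro!: derivative_eq_intros)
  have le: "4 * (N * exp (- 2 * t)) \<le> rhs1 a t (N * exp (- 2 * t)) (q * N * exp (- 2 * t))"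
    "4 * (q * N * exp (- 2 * t)) \<le> rhs2 b t (N * exp (- 2 * t)) (q * N * exp (- 2 * t))" for t
  proof -
    define y where "y = N * exp (- 2 * t)"
    have y: "0 < y" using N0 by (simp add: y_def)
    have ty: "exp (2 * t) * y = N" by (simp add: y_def mult_exp_exp)
    have yq: "y \<le> q * y" using y ab by (simp add: q algebra_simps)
    define X where "X = exp (a * y / 2) - 1"
    have X: "(a * y / 2)\<^sup>2 / 2 \<le> X"
      using exp_lower_Taylor_quadratic[of "a * y / 2"] mult_pos_pos[OF ab(1) y] unfolding X_def by linarith
    have X0: "0 \<le> X" using X by (meson order_trans zero_le_divide_iff zero_le_numeral zero_le_power2)
    have "8 * q \<le> N * a\<^sup>2" using N ab by (simp add: field_simps)
    then have "8 * q * y \<le> N * a\<^sup>2 * y" using y by (intro mult_right_mono) auto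
    also have "\<dots> = (exp (2 * t) * y) * a\<^sup>2 * y" by (simp add: ty)
    also have "\<dots> = 8 * exp (2 * t) * ((a * y / 2)\<^sup>2 / 2)" by (simp add: power2_eq_square)
    also have "\<dots> \<le> 8 * exp (2 * t) * X" using X by (intro mult_left_mono) auto
    finally have qX: "4 * (q * y) \<le> 4 * exp (2 * t) * X" by simp
    have "exp (a * y) = exp (a * y / 2) * exp (a * y / 2)" by (simp add: mult_exp_exp)
    then have "exp (a * y) = (X + 1) * (X + 1)" by (simp add: X_def)
    then have "X \<le> exp (a * y) - (X + 1)" using X0 by (simp add: algebra_simps)
    moreover have "exp (q * y - y) = X + 1" by (simp add: X_def q algebra_simps)
    ultimately have "X \<le> exp (a * y) - exp (q * y - y)" by simp
    then have 1: "4 * exp (2 * t) * X \<le> rhs1 a t y (q * y)"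
      unfolding rhs1_def by (intro mult_left_mono) auto
    have "exp (- b * (q * y)) \<le> 1" using ab y yq by simp
    then have "X \<le> exp (q * y - y) - exp (- b * (q * y))"
      using \<open>exp (q * y - y) = X + 1\<close> by simp
    then have 2: "4 * exp (2 * t) * X \<le> rhs2 b t y (q * y)"
      unfolding rhs2_def by (intro mult_left_mono) auto
    show "4 * (N * exp (- 2 * t)) \<le> rhs1 a t (N * exp (- 2 * t)) (q * N * exp (- 2 * t))"
      "4 * (q * N * exp (- 2 * t)) \<le> rhs2 b t (N * exp (- 2 * t)) (q * N * exp (- 2 * t))"
      using 1 2 qX yq unfolding mult.assoc y_def[symmetric] by linarith+
  qed
  show ?thesis
    unfolding ode_supersolution_def
    using der[of N] der[of "q * N"] le by (auto simp: mult.assoc)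
qed

lemma bvp_solution_upper_decay:
  assumes ab: "0 < a" "0 < b"
  shows "\<exists>M>0. \<forall>T u v. 0 < T \<longrightarrow> bvp_solution a b \<gamma> \<delta> T u v \<longrightarrow>
    (\<forall>t\<in>{- T..T}. u t \<le> M * exp (- 2 * t) \<and> v t \<le> M * exp (- 2 * t))"
proof -
  define q where "q = 1 + a / 2"
  \<comment> \<open>The first summand is the requirement of the supersolution; the other two let it
    dominate the boundary values at \<open>- T\<close>, because T <= exp(2T).\<close>
  define N where "N = 8 * q / a\<^sup>2 + \<bar>\<gamma>\<bar> + \<bar>\<delta>\<bar>"
  have q: "1 \<le> q" using ab by (simp add: q_def)
  have N: "8 * q / a\<^sup>2 \<le> N" "\<bar>\<gamma>\<bar> \<le> N" "\<bar>\<delta>\<bar> \<le> N" "0 < N"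
    using ab q by (auto simp: N_def add_nonneg_nonneg add_pos_nonneg)
  have qN: "N \<le> q * N" using q N by simp
  have "\<forall>t\<in>{- T..T}. u t \<le> q * N * exp (- 2 * t) \<and> v t \<le> q * N * exp (- 2 * t)"
    if T: "0 < T" and sol: "bvp_solution a b \<gamma> \<delta> T u v" for T u v
  proof
    fix t assume t: "t \<in> {- T..T}"
    have lin: "- c * T \<le> M * exp (- 2 * - T)" if "\<bar>c\<bar> \<le> M" for c M
    proof -
      have "- c * T \<le> M * T" using that T by (intro mult_right_mono) auto
      also have "\<dots> \<le> M * exp (2 * T)"
        using that T exp_ge_add_one_self[of "2 * T"] by (intro mult_left_mono; linarith)
      finally show ?thesis by simp
    qed
    have "u t \<le> N * exp (- 2 * t) \<and> v t \<le> q * N * exp (- 2 * t)"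
    proof (rule ode_comparison[OF ab _ exponential_supersolution[OF ab q_def N(1)] _ _ _ _ _ _ _ _ t])
      show "u (- T) \<le> N * exp (- 2 * - T)" "v (- T) \<le> q * N * exp (- 2 * - T)"
        using sol lin[of \<gamma> N] lin[of \<delta> "q * N"] N qN by (simp_all add: bvp_solution_def)
      show "u T \<le> N * exp (- 2 * T)" "v T \<le> q * N * exp (- 2 * T)"
        using sol N q by (simp_all add: bvp_solution_def)
    qed (use sol in \<open>auto simp: bvp_solution_def intro!: continuous_intros\<close>)
    moreover have "N * exp (- 2 * t) \<le> q * N * exp (- 2 * t)"
      using qN by (intro mult_right_mono) auto
    ultimately show "u t \<le> q * N * exp (- 2 * t) \<and> v t \<le> q * N * exp (- 2 * t)" by linarith
  qed
  moreover have "0 < q * N" using q N by simp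
  ultimately show ?thesis by blast
qed

lemma bvp_solution_decay:
  assumes ab: "0 < a" "0 < b"
  shows "\<exists>M>0. \<forall>T u v. 0 < T \<longrightarrow> bvp_solution a b \<gamma> \<delta> T u v \<longrightarrow>
    (\<forall>t\<in>{- T..T}. \<bar>u t\<bar> \<le> M * exp (- 2 * t) \<and> \<bar>v t\<bar> \<le> M * exp (- 2 * t))"
proof -
  obtain M1 where M1: "M1 > 0" "\<And>T u v t. 0 < T \<Longrightarrow> bvp_solution a b \<gamma> \<delta> T u v \<Longrightarrow> t \<in> {- T..T} \<Longrightarrow>
      u t \<le> M1 * exp (- 2 * t) \<and> v t \<le> M1 * exp (- 2 * t)"
    using bvp_solution_upper_decay[OF ab, of \<gamma> \<delta>] by blast
  obtain M2 where M2: "M2 > 0" "\<And>T u v t. 0 < T \<Longrightarrow> bvp_solution b a (- \<delta>) (- \<gamma>) T u v \<Longrightarrow> t \<in> {- T..T} \<Longrightarrow>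
      u t \<le> M2 * exp (- 2 * t) \<and> v t \<le> M2 * exp (- 2 * t)"
    using bvp_solution_upper_decay[OF ab(2,1), of "- \<delta>" "- \<gamma>"] by blast
  have "\<bar>u t\<bar> \<le> max M1 M2 * exp (- 2 * t) \<and> \<bar>v t\<bar> \<le> max M1 M2 * exp (- 2 * t)"
    if "0 < T" "bvp_solution a b \<gamma> \<delta> T u v" "t \<in> {- T..T}" for T u v t
  proof -
    have "M1 * exp (- 2 * t) \<le> max M1 M2 * exp (- 2 * t)" "M2 * exp (- 2 * t) \<le> max M1 M2 * exp (- 2 * t)"
      by (intro mult_right_mono; simp)+
    then show ?thesis
      using M1(2)[OF that] M2(2)[OF that(1) bvp_solution_reflect[OF that(2)] that(3)]
      unfolding abs_le_iff by linarith
  qed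
  moreover have "max M1 M2 > 0" using M1 by simp
  ultimately show ?thesis by blast
qed

text \<open>As \<open>t \<rightarrow> - \<infinity>\<close> only the coupling term \<open>exp (v - u)\<close> in the first equation and \<open>exp (- b v)\<close> in the
  second one hurt a supersolution; the other two terms have the good sign and are dropped.\<close>

lemma bvp_solution_upper_left:
  assumes ab: "0 < a" "0 < b"
    and p: "has_deriv2_on p p2 {..<0}" and q: "has_deriv2_on q q2 {..<0}"
    and cont: "continuous_on {..0} p" "continuous_on {..0} q"
    and low: "\<And>t. t \<le> 0 \<Longrightarrow> - 1 \<le> p t" "\<And>t. t \<le> 0 \<Longrightarrow> - 1 \<le> q t" and k: "0 < k"
    and q2: "\<And>t. t < 0 \<Longrightarrow> q2 t \<le> - k * exp ((2 - b * \<delta>) * t - b * q t)"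
    and p2: "\<And>t. t < 0 \<Longrightarrow> p2 t \<le> - k * exp ((2 + \<delta> - \<gamma>) * t + q t - p t)"
  shows "\<exists>C. \<forall>T u v. 0 < T \<longrightarrow> bvp_solution a b \<gamma> \<delta> T u v \<longrightarrow>
    (\<forall>t\<in>{- T..0}. u t \<le> \<gamma> * t + p t + C \<and> v t \<le> \<delta> * t + q t + C)"
proof -
  obtain M where M: "M > 0" "\<And>T u v t. 0 < T \<Longrightarrow> bvp_solution a b \<gamma> \<delta> T u v \<Longrightarrow> t \<in> {- T..T} \<Longrightarrow>
      \<bar>u t\<bar> \<le> M * exp (- 2 * t) \<and> \<bar>v t\<bar> \<le> M * exp (- 2 * t)"
    using bvp_solution_decay[OF ab, of \<gamma> \<delta>] by blast
  \<comment> \<open>Measures the factor between the 4 of the equations and the \<open>k\<close> of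
    the hypotheses, in the form \<open>4 * exp (- l) <= k\<close>.\<close>
  define l where "l = \<bar>ln (4 / k)\<bar>"
  have l: "4 * exp (- l) \<le> k"
  proof -
    have "ln (4 / k) \<le> l" by (simp add: l_def)
    then have "4 / k \<le> exp l" using k by (metis divide_pos_pos exp_le_cancel_iff exp_ln zero_less_numeral)
    then show ?thesis using k by (simp add: exp_minus field_simps)
  qed
  \<comment> \<open>\<open>b * c2 >= l\<close> absorbs that factor in the second equation and
    \<open>c1 - c2 = l\<close> absorbs it in the first. The part \<open>M + 1\<close> secures the
    boundary comparison: at 0 the solutions are at most \<open>M\<close>, and \<open>p\<close>,
    \<open>q\<close> are at least -1.\<close>
  define c2 where "c2 = M + 1 + l / b"
  define c1 where "c1 = c2 + l"
  have l0: "0 \<le> l" by (simp add: l_def)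
  have c2: "M + 1 \<le> c2" "l \<le> b * c2" using l0 ab M(1) by (auto simp: c2_def algebra_simps)
  have c1: "M + 1 \<le> c1" "c2 \<le> c1" using l0 c2 by (auto simp: c1_def)
  define U where "U t = (c1 + \<gamma> * t) + p t" for t
  define V where "V t = (c2 + \<delta> * t) + q t" for t
  have bound: "4 * exp (2 * t) * exp y \<le> k * exp z" if "2 * t + y \<le> z - l" for t y z
  proof -
    have "4 * exp (2 * t) * exp y = 4 * exp (2 * t + y)" by (simp add: exp_add)
    also have "\<dots> \<le> 4 * exp (- l + z)" using that by simp
    also have "\<dots> = (4 * exp (- l)) * exp z" by (simp only: exp_add mult.assoc)
    also have "\<dots> \<le> k * exp z" using l by (intro mult_right_mono) auto
    finally show ?thesis .
  qed
  have super: "ode_supersolution a b U V {..<0}"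
    unfolding ode_supersolution_def
  proof (intro exI conjI ballI)
    show "has_deriv2_on U (\<lambda>t. 0 + p2 t) {..<0}" "has_deriv2_on V (\<lambda>t. 0 + q2 t) {..<0}"
      unfolding U_def V_def by (intro has_deriv2_on_add has_deriv2_on_affine p q)+
    fix t :: real assume t: "t \<in> {..<0}"
    have "2 * t + (V t - U t) = ((2 + \<delta> - \<gamma>) * t + q t - p t) - l"
      by (simp add: U_def V_def c1_def algebra_simps)
    then have "4 * exp (2 * t) * exp (V t - U t) \<le> k * exp ((2 + \<delta> - \<gamma>) * t + q t - p t)"
      by (intro bound) simp
    moreover have "- (4 * exp (2 * t) * exp (V t - U t)) \<le> rhs1 a t (U t) (V t)"
      by (simp add: rhs1_def algebra_simps)
    ultimately show "0 + p2 t \<le> rhs1 a t (U t) (V t)" using p2[of t] t by simp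
    have "2 * t + - b * V t \<le> ((2 - b * \<delta>) * t - b * q t) - l"
      using c2 by (simp add: V_def algebra_simps)
    then have "4 * exp (2 * t) * exp (- b * V t) \<le> k * exp ((2 - b * \<delta>) * t - b * q t)"
      by (rule bound)
    moreover have "- (4 * exp (2 * t) * exp (- b * V t)) \<le> rhs2 b t (U t) (V t)"
      by (simp add: rhs2_def algebra_simps)
    ultimately show "0 + q2 t \<le> rhs2 b t (U t) (V t)" using q2[of t] t by simp
  qed
  have "u t \<le> \<gamma> * t + p t + c1 \<and> v t \<le> \<delta> * t + q t + c1"
    if T: "0 < T" and sol: "bvp_solution a b \<gamma> \<delta> T u v" and t: "t \<in> {- T..0}" for T u v t
  proof -
    have "u t \<le> U t \<and> v t \<le> V t"
    proof (rule ode_comparison[OF ab, where c = "- T" and d = 0 and t = t and u = u and v = v and U = U and V = V])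
      show "ode_solution a b u v {- T<..<0}"
        using sol T by (auto simp: bvp_solution_def intro: ode_solution_subset)
      show "ode_supersolution a b U V {- T<..<0}"
        using super by (rule ode_supersolution_subset) auto
      have "{- T..0} \<subseteq> {- T..T}" using T by auto
      then show "continuous_on {- T..0} u" "continuous_on {- T..0} v"
        using sol by (auto simp: bvp_solution_def intro: continuous_on_subset)
      have "continuous_on {- T..0} p" "continuous_on {- T..0} q"
        using cont by (auto intro: continuous_on_subset)
      then show "continuous_on {- T..0} U" "continuous_on {- T..0} V"
        unfolding U_def V_def by (auto intro!: continuous_intros)
      show "u (- T) \<le> U (- T)" "v (- T) \<le> V (- T)"
        using sol T low[of "- T"] c1 c2 M(1) by (auto simp: bvp_solution_def U_def V_def)
      show "u 0 \<le> U 0" "v 0 \<le> V 0"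
        using M(2)[OF T sol, of 0] T low[of 0] c1 c2 by (auto simp: U_def V_def)
    qed (rule t)
    then show ?thesis using c1 by (auto simp: U_def V_def)
  qed
  then show ?thesis by blast
qed

text \<open>The exponents multiplying \<open>t\<close> may vanish here, so the decay of the sources
  has to come from the corrections themselves: with powers of \<open>1 - t\<close> both sides of the
  differential inequalities have order (1 - t)^(-2).\<close>

lemma bvp_solution_upper_log:
  assumes ab: "0 < a" "0 < b" and region: "b * \<delta> \<le> 2" "\<gamma> - \<delta> \<le> 2"
  shows "\<exists>L C. 0 \<le> L \<and> (\<forall>T u v. 0 < T \<longrightarrow> bvp_solution a b \<gamma> \<delta> T u v \<longrightarrow>
    (\<forall>t\<in>{- T..0}. u t \<le> \<gamma> * t + L * ln (1 - t) + C \<and> v t \<le> \<delta> * t + L * ln (1 - t) + C))"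
proof -
  \<comment> \<open>Chosen so that \<open>exp (- b * (m * ln (1 - t)))\<close> is (1 - t)^(-2),
    matching the second derivative of the correction. The coefficient \<open>2 + m\<close> for
    \<open>u\<close> makes the difference of the two corrections \<open>2 * ln (1 - t)\<close>, with
    the same effect in the first equation.\<close>
  define m where "m = 2 / b"
  have m: "0 < m" "b * m = 2" using ab by (auto simp: m_def)
  have der: "has_deriv2_on (\<lambda>t. L * ln (1 - t)) (\<lambda>t. - L / (1 - t)\<^sup>2) {..<0}" for L
    by (rule has_deriv2_onI[where ?f1.0 = "\<lambda>t. - L / (1 - t)"])
      (auto intro!: derivative_eq_intros simp: power2_eq_square)
  have cont: "continuous_on {..0} (\<lambda>t. L * ln (1 - t :: real))" for L
    by (auto intro!: continuous_intros)
  have sq: "exp (- 2 * ln (1 - t)) = 1 / (1 - t)\<^sup>2" if "t < 0" for t :: real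
    using that by (simp add: exp_minus exp_double field_simps)
  have est: "- L / (1 - t)\<^sup>2 \<le> - m * exp (\<theta> * t + - 2 * ln (1 - t))"
    if "t < 0" "0 \<le> \<theta>" "m \<le> L" for L t \<theta> :: real
  proof -
    have "exp (\<theta> * t + - 2 * ln (1 - t)) \<le> exp (- 2 * ln (1 - t))"
      using that by (simp add: mult_nonneg_nonpos)
    also note sq[OF that(1)]
    finally have "m * exp (\<theta> * t + - 2 * ln (1 - t)) \<le> L * (1 / (1 - t)\<^sup>2)"
      using that m by (intro mult_mono) auto
    then show ?thesis by simp
  qed
  have "\<exists>C. \<forall>T u v. 0 < T \<longrightarrow> bvp_solution a b \<gamma> \<delta> T u v \<longrightarrow>
    (\<forall>t\<in>{- T..0}. u t \<le> \<gamma> * t + (2 + m) * ln (1 - t) + C \<and> v t \<le> \<delta> * t + m * ln (1 - t) + C)"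
  proof (rule bvp_solution_upper_left[OF ab der der cont cont _ _ m(1)])
    show "- 1 \<le> (2 + m) * ln (1 - t)" "- 1 \<le> m * ln (1 - t)" if "t \<le> 0" for t
    proof -
      have "0 \<le> (2 + m) * ln (1 - t)" "0 \<le> m * ln (1 - t)" using that m by simp_all
      then show "- 1 \<le> (2 + m) * ln (1 - t)" "- 1 \<le> m * ln (1 - t)" by linarith+
    qed
    show "- m / (1 - t)\<^sup>2 \<le> - m * exp ((2 - b * \<delta>) * t - b * (m * ln (1 - t)))" if "t < 0" for t
    proof -
      have eq: "(2 - b * \<delta>) * t - b * (m * ln (1 - t)) = (2 - b * \<delta>) * t + - 2 * ln (1 - t)"
        using m(2) by (simp add: mult.assoc[symmetric])
      have "0 \<le> 2 - b * \<delta>" using region by simp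
      then show ?thesis unfolding eq by (rule est[OF that _ order_refl])
    qed
    show "- (2 + m) / (1 - t)\<^sup>2 \<le> - m * exp ((2 + \<delta> - \<gamma>) * t + m * ln (1 - t) - (2 + m) * ln (1 - t))"
      if "t < 0" for t
    proof -
      have eq: "(2 + \<delta> - \<gamma>) * t + m * ln (1 - t) - (2 + m) * ln (1 - t) = (2 + \<delta> - \<gamma>) * t + - 2 * ln (1 - t)"
        by (simp add: algebra_simps)
      have "0 \<le> 2 + \<delta> - \<gamma>" "m \<le> 2 + m" using region by simp_all
      then show ?thesis unfolding eq by (rule est[OF that])
    qed
  qed
  then obtain C where C: "\<And>T u v t. 0 < T \<Longrightarrow> bvp_solution a b \<gamma> \<delta> T u v \<Longrightarrow> t \<in> {- T..0} \<Longrightarrow>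
      u t \<le> \<gamma> * t + (2 + m) * ln (1 - t) + C \<and> v t \<le> \<delta> * t + m * ln (1 - t) + C" by blast
  have "u t \<le> \<gamma> * t + (2 + m) * ln (1 - t) + C \<and> v t \<le> \<delta> * t + (2 + m) * ln (1 - t) + C"
    if "0 < T" "bvp_solution a b \<gamma> \<delta> T u v" "t \<in> {- T..0}" for T u v t
  proof -
    have "m * ln (1 - t) \<le> (2 + m) * ln (1 - t)" using that by (intro mult_right_mono) auto
    then show ?thesis using C[OF that] by linarith
  qed
  moreover have "0 \<le> 2 + m" using m by simp
  ultimately show ?thesis by blast
qed

text \<open>Strict inequalities make the sources decay like exp(\<theta> t) and exp(\<sigma> t). The
  second derivative of \<open>- exp (s * t)\<close> is a negative multiple of the same exponential,
  so a bounded correction suffices.\<close>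

lemma bvp_solution_upper_interior:
  assumes ab: "0 < a" "0 < b" and region: "b * \<delta> < 2" "\<gamma> - \<delta> < 2"
  shows "\<exists>C. \<forall>T u v. 0 < T \<longrightarrow> bvp_solution a b \<gamma> \<delta> T u v \<longrightarrow>
    (\<forall>t\<in>{- T..0}. u t \<le> \<gamma> * t + C \<and> v t \<le> \<delta> * t + C)"
proof -
  define \<theta> where "\<theta> = 2 - b * \<delta>"
  define \<sigma> where "\<sigma> = 2 + \<delta> - \<gamma>"
  have pos: "0 < \<theta>" "0 < \<sigma>" using region by (auto simp: \<theta>_def \<sigma>_def)
  have der: "has_deriv2_on (\<lambda>t. - exp (s * t)) (\<lambda>t. - (s\<^sup>2 * exp (s * t))) {..<0}" for s
    by (rule has_deriv2_onI[where ?f1.0 = "\<lambda>t. - (s * exp (s * t))"])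
      (auto intro!: derivative_eq_intros simp: power2_eq_square)
  have cont: "continuous_on {..0} (\<lambda>t. - exp (s * t :: real))" for s
    by (auto intro!: continuous_intros)
  \<comment> \<open>The factors \<open>exp (- b)\<close> and \<open>exp (- 1)\<close> pay for the
    corrections inside the exponents, which are at most \<open>b\<close> and 1 for negative
    \<open>t\<close>.\<close>
  define k where "k = min (\<theta>\<^sup>2 * exp (- b)) (\<sigma>\<^sup>2 * exp (- 1))"
  have k: "0 < k" "k \<le> \<theta>\<^sup>2 * exp (- b)" "k \<le> \<sigma>\<^sup>2 * exp (- 1)" using pos by (auto simp: k_def)
  have est: "- (s\<^sup>2 * exp (s * t)) \<le> - k * exp (s * t + y)"
    if "k \<le> s\<^sup>2 * exp (- c)" "y \<le> c" for s t y c :: real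
  proof -
    have "k * exp (s * t + y) \<le> (s\<^sup>2 * exp (- c)) * exp (s * t + c)"
      using that k by (intro mult_mono) auto
    also have "\<dots> = s\<^sup>2 * exp (s * t)" by (simp add: exp_add exp_minus)
    finally show ?thesis by simp
  qed
  have e1: "exp (s * t) \<le> 1" if "0 < s" "t \<le> 0" for s t :: real
    using that by (simp add: mult_nonneg_nonpos)
  have "\<exists>C. \<forall>T u v. 0 < T \<longrightarrow> bvp_solution a b \<gamma> \<delta> T u v \<longrightarrow>
    (\<forall>t\<in>{- T..0}. u t \<le> \<gamma> * t + - exp (\<sigma> * t) + C \<and> v t \<le> \<delta> * t + - exp (\<theta> * t) + C)"
  proof (rule bvp_solution_upper_left[OF ab der der cont cont _ _ k(1)])
    show "- 1 \<le> - exp (\<sigma> * t)" "- 1 \<le> - exp (\<theta> * t)" if "t \<le> 0" for t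
      using e1 pos that by auto
    show "- (\<theta>\<^sup>2 * exp (\<theta> * t)) \<le> - k * exp ((2 - b * \<delta>) * t - b * - exp (\<theta> * t))" if "t < 0" for t
      using est[OF k(2), of "b * exp (\<theta> * t)" t] e1[OF pos(1), of t] ab that by (simp add: \<theta>_def)
    show "- (\<sigma>\<^sup>2 * exp (\<sigma> * t)) \<le> - k * exp ((2 + \<delta> - \<gamma>) * t + - exp (\<theta> * t) - - exp (\<sigma> * t))" if "t < 0" for t
    proof -
      have "exp (\<sigma> * t) - exp (\<theta> * t) \<le> 1" using e1[OF pos(2), of t] that exp_gt_zero[of "\<theta> * t"] by linarith
      from est[OF k(3) this, of t] show ?thesis by (simp add: \<sigma>_def algebra_simps)
    qed
  qed
  then obtain C where C: "\<And>T u v t. 0 < T \<Longrightarrow> bvp_solution a b \<gamma> \<delta> T u v \<Longrightarrow> t \<in> {- T..0} \<Longrightarrow>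
      u t \<le> \<gamma> * t + - exp (\<sigma> * t) + C \<and> v t \<le> \<delta> * t + - exp (\<theta> * t) + C" by blast
  have "u t \<le> \<gamma> * t + C \<and> v t \<le> \<delta> * t + C"
    if "0 < T" "bvp_solution a b \<gamma> \<delta> T u v" "t \<in> {- T..0}" for T u v t
    using C[OF that] exp_gt_zero[of "\<sigma> * t"] exp_gt_zero[of "\<theta> * t"] by linarith
  then show ?thesis by blast
qed

section \<open>The radial solution on the whole line\<close>

lemma bvp_solution_log_bound:
  assumes ab: "0 < a" "0 < b" and region: "(\<gamma>, \<delta>) \<in> region a b"
  shows "\<exists>L C. 0 \<le> L \<and> (\<forall>T u v. 0 < T \<longrightarrow> bvp_solution a b \<gamma> \<delta> T u v \<longrightarrow>
    (\<forall>t\<in>{- T..0}. \<bar>u t - \<gamma> * t\<bar> \<le> L * ln (1 - t) + C \<and> \<bar>v t - \<delta> * t\<bar> \<le> L * ln (1 - t) + C))"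
proof -
  \<comment> \<open>The region is invariant under reflection: the lower bound on \<gamma> becomes
    the condition on the second component of the reflected problem, while the condition on \<gamma>
    - \<delta> maps to itself.\<close>
  have r: "b * \<delta> \<le> 2" "\<gamma> - \<delta> \<le> 2" "a * - \<gamma> \<le> 2" "- \<delta> - - \<gamma> \<le> 2"
    using region ab by (auto simp: region_def field_simps)
  obtain L1 C1 where 1: "0 \<le> L1" "\<And>T u v t. 0 < T \<Longrightarrow> bvp_solution a b \<gamma> \<delta> T u v \<Longrightarrow> t \<in> {- T..0} \<Longrightarrow>
      u t \<le> \<gamma> * t + L1 * ln (1 - t) + C1 \<and> v t \<le> \<delta> * t + L1 * ln (1 - t) + C1"
    using bvp_solution_upper_log[OF ab r(1,2)] by blast
  obtain L2 C2 where 2: "0 \<le> L2" "\<And>T u v t. 0 < T \<Longrightarrow> bvp_solution b a (- \<delta>) (- \<gamma>) T u v \<Longrightarrow> t \<in> {- T..0} \<Longrightarrow>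
      u t \<le> - \<delta> * t + L2 * ln (1 - t) + C2 \<and> v t \<le> - \<gamma> * t + L2 * ln (1 - t) + C2"
    using bvp_solution_upper_log[OF ab(2,1) r(3,4)] by blast
  have "\<bar>u t - \<gamma> * t\<bar> \<le> max L1 L2 * ln (1 - t) + max C1 C2 \<and> \<bar>v t - \<delta> * t\<bar> \<le> max L1 L2 * ln (1 - t) + max C1 C2"
    if "0 < T" "bvp_solution a b \<gamma> \<delta> T u v" "t \<in> {- T..0}" for T u v t
  proof -
    have "L1 * ln (1 - t) \<le> max L1 L2 * ln (1 - t)" "L2 * ln (1 - t) \<le> max L1 L2 * ln (1 - t)"
      using that by (intro mult_right_mono; simp)+
    moreover have "- \<delta> * t = - (\<delta> * t)" "- \<gamma> * t = - (\<gamma> * t)" by simp_all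
    ultimately show ?thesis
      using 1(2)[OF that] 2(2)[OF that(1) bvp_solution_reflect[OF that(2)] that(3)]
      unfolding abs_le_iff by linarith
  qed
  moreover have "0 \<le> max L1 L2" using 1 by simp
  ultimately show ?thesis by blast
qed

lemma bvp_solution_interior_bound:
  assumes ab: "0 < a" "0 < b" and region: "- 2 / a < \<gamma>" "\<delta> < 2 / b" "\<gamma> - \<delta> < 2"
  shows "\<exists>C. \<forall>T u v. 0 < T \<longrightarrow> bvp_solution a b \<gamma> \<delta> T u v \<longrightarrow>
    (\<forall>t\<in>{- T..0}. \<bar>u t - \<gamma> * t\<bar> \<le> C \<and> \<bar>v t - \<delta> * t\<bar> \<le> C)"
proof -
  have r: "b * \<delta> < 2" "\<gamma> - \<delta> < 2" "a * - \<gamma> < 2" "- \<delta> - - \<gamma> < 2"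
    using region ab by (auto simp: field_simps)
  obtain C1 where 1: "\<And>T u v t. 0 < T \<Longrightarrow> bvp_solution a b \<gamma> \<delta> T u v \<Longrightarrow> t \<in> {- T..0} \<Longrightarrow>
      u t \<le> \<gamma> * t + C1 \<and> v t \<le> \<delta> * t + C1"
    using bvp_solution_upper_interior[OF ab r(1,2)] by blast
  obtain C2 where 2: "\<And>T u v t. 0 < T \<Longrightarrow> bvp_solution b a (- \<delta>) (- \<gamma>) T u v \<Longrightarrow> t \<in> {- T..0} \<Longrightarrow>
      u t \<le> - \<delta> * t + C2 \<and> v t \<le> - \<gamma> * t + C2"
    using bvp_solution_upper_interior[OF ab(2,1) r(3,4)] by blast
  have "\<bar>u t - \<gamma> * t\<bar> \<le> max C1 C2 \<and> \<bar>v t - \<delta> * t\<bar> \<le> max C1 C2"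
    if "0 < T" "bvp_solution a b \<gamma> \<delta> T u v" "t \<in> {- T..0}" for T u v t
  proof -
    have "- \<delta> * t = - (\<delta> * t)" "- \<gamma> * t = - (\<gamma> * t)" by simp_all
    then show ?thesis
      using 1[OF that] 2[OF that(1) bvp_solution_reflect[OF that(2)] that(3)]
      unfolding abs_le_iff by linarith
  qed
  then show ?thesis by blast
qed

text \<open>The second solution, raised by the affine function
  \<open>2 * h + l * (R - t) / J\<close>, is a supersolution on \<open>{- J..R}\<close>. The slack
  is \<open>2 * h\<close> at \<open>R\<close>, where all four values are small, and at least
  \<open>l\<close> at \<open>- J\<close>. For fixed \<open>t\<close> it is close to
  \<open>2 * h\<close> once \<open>l / J\<close> is small.\<close>

lemma bvp_solution_le:
  assumes ab: "0 < a" "0 < b" and R: "0 \<le> R" "R \<le> S" "R \<le> T"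
    and sol: "bvp_solution a b \<gamma> \<delta> S u v" "bvp_solution a b \<gamma> \<delta> T U V"
    and J: "0 < J" "J \<le> S" "J \<le> T"
    and right: "\<And>w. w \<in> {u, v, U, V} \<Longrightarrow> \<bar>w R\<bar> \<le> h"
    and left: "u (- J) \<le> U (- J) + l" "v (- J) \<le> V (- J) + l" and l: "0 \<le> l"
    and t: "t \<in> {- J..R}"
  shows "u t \<le> U t + (2 * h + l * (R - t) / J) \<and> v t \<le> V t + (2 * h + l * (R - t) / J)"
proof -
  have h: "0 \<le> h" using right[of u] by (simp add: order_trans[OF abs_ge_zero])
  have eq: "2 * h + l * (R - t) / J = (2 * h + l * R / J) + (- l / J) * t" for t
    by (simp add: diff_divide_distrib right_diff_distrib)
  have sub: "{- J..R} \<subseteq> {- S..S}" "{- J..R} \<subseteq> {- T..T}" "{- J<..<R} \<subseteq> {- S<..<S}" "{- J<..<R} \<subseteq> {- T<..<T}"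
    using R J by auto
  have cont: "continuous_on {- J..R} u" "continuous_on {- J..R} v" "continuous_on {- J..R} U" "continuous_on {- J..R} V"
    using sol sub unfolding bvp_solution_def by (meson continuous_on_subset)+
  have "u t \<le> U t + ((2 * h + l * R / J) + (- l / J) * t) \<and> v t \<le> V t + ((2 * h + l * R / J) + (- l / J) * t)"
  proof (rule ode_comparison[OF ab _ supersolution_shift[OF ab] _ _ _ _ _ _ _ _ t])
    show "ode_solution a b u v {- J<..<R}" "ode_solution a b U V {- J<..<R}"
      using sol sub unfolding bvp_solution_def by (meson ode_solution_subset)+
    show "0 \<le> (2 * h + l * R / J) + (- l / J) * t" if "t \<in> {- J<..<R}" for t
      unfolding eq[symmetric] using h l J that by simp
    have "l \<le> l * (R - - J) / J" using l R J by (simp add: field_simps)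
    then show "u (- J) \<le> U (- J) + ((2 * h + l * R / J) + (- l / J) * - J)"
      "v (- J) \<le> V (- J) + ((2 * h + l * R / J) + (- l / J) * - J)"
      unfolding eq[symmetric] using left h by linarith+
    have "2 * h + l * (R - R) / J = 2 * h" by simp
    then show "u R \<le> U R + ((2 * h + l * R / J) + (- l / J) * R)" "v R \<le> V R + ((2 * h + l * R / J) + (- l / J) * R)"
      unfolding eq[symmetric] using right[of u] right[of v] right[of U] right[of V] by (simp; linarith)+
  qed (use cont J in \<open>auto intro!: continuous_intros\<close>)
  then show ?thesis unfolding eq .
qed

lemma ode_solution_limit:
  fixes u v :: "nat \<Rightarrow> real \<Rightarrow> real"
  assumes ab: "0 < a" "0 < b" and R: "0 < R"
    and cont: "\<And>n. continuous_on {- R..R} (u n)" "\<And>n. continuous_on {- R..R} (v n)"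
    and sol: "\<And>n. ode_solution a b (u n) (v n) {- R<..<R}"
    and bound: "\<And>n t. t \<in> {- R..R} \<Longrightarrow> \<bar>u n t\<bar> \<le> B \<and> \<bar>v n t\<bar> \<le> B"
    and lim: "\<And>t. (\<lambda>n. u n t) \<longlonglongrightarrow> U t" "\<And>t. (\<lambda>n. v n t) \<longlonglongrightarrow> V t"
  shows "ode_solution a b U V {- R<..<R}"
proof -
  have R': "- R < R" using R by simp
  have bd: "\<bar>rhs1 a t (u n t) (v n t)\<bar> \<le> 4 * exp (2 * R) * (exp (a * B) + exp (2 * B))"
    "\<bar>rhs2 b t (u n t) (v n t)\<bar> \<le> 4 * exp (2 * R) * (exp (b * B) + exp (2 * B))" if "t \<in> {- R..R}" for n t
    using ab bound[OF that] that by (intro abs_rhs1_le abs_rhs2_le; simp)+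
  have ch: "continuous_on {- R..R} (\<lambda>t. rhs1 a t (u n t) (v n t))"
    "continuous_on {- R..R} (\<lambda>t. rhs2 b t (u n t) (v n t))" for n
    by (intro continuous_intros cont)+
  have lh: "(\<lambda>n. rhs1 a t (u n t) (v n t)) \<longlonglongrightarrow> rhs1 a t (U t) (V t)"
    "(\<lambda>n. rhs2 b t (u n t) (v n t)) \<longlonglongrightarrow> rhs2 b t (U t) (V t)" for t
    unfolding rhs1_def rhs2_def by (intro tendsto_intros lim)+
  have du: "has_deriv2_on (u n) (\<lambda>t. rhs1 a t (u n t) (v n t)) {- R<..<R}"
    and dv: "has_deriv2_on (v n) (\<lambda>t. rhs2 b t (u n t) (v n t)) {- R<..<R}" for n
    using sol[of n] unfolding ode_solution_def by simp_all
  note limU = deriv2_limit[OF R' cont(1) ch(1) du bd(1) lim(1) lh(1)]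
  note limV = deriv2_limit[OF R' cont(2) ch(2) dv bd(2) lim(2) lh(2)]
  have UV: "continuous_on {- R..R} U" "continuous_on {- R..R} V" using limU(1) limV(1) by auto
  have "continuous_on {- R..R} (\<lambda>t. rhs1 a t (U t) (V t))" "continuous_on {- R..R} (\<lambda>t. rhs2 b t (U t) (V t))"
    by (intro continuous_on_rhs UV)+
  then show ?thesis
    using limU(2) limV(2) unfolding ode_solution_def by simp
qed

text \<open>The hidden first derivatives may depend on \<open>R\<close>; \<open>deriv f\<close>
  agrees locally with each of them and glues them together.\<close>

lemma has_deriv2_on_UNIV:
  assumes "\<And>R. 0 < R \<Longrightarrow> has_deriv2_on f f2 {- R<..<R}"
  shows "has_deriv2_on f f2 UNIV"
proof (rule has_deriv2_onI)
  fix t :: real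
  define R where "R = \<bar>t\<bar> + 1"
  have t: "t \<in> {- R<..<R}" "0 < R" by (auto simp: R_def)
  obtain f1 where f1: "\<And>s. s \<in> {- R<..<R} \<Longrightarrow>
      (f has_real_derivative f1 s) (at s) \<and> (f1 has_real_derivative f2 s) (at s)"
    using assms[OF t(2)] unfolding has_deriv2_on_def by blast
  show "(f has_real_derivative deriv f t) (at t)"
    using f1[OF t(1)] DERIV_imp_deriv by fastforce
  have "\<forall>\<^sub>F s in nhds t. s \<in> {- R<..<R}"
    using t by (intro eventually_nhds_in_open) auto
  then have "\<forall>\<^sub>F s in nhds t. deriv f s = f1 s"
    by (rule eventually_mono) (use f1 DERIV_imp_deriv in blast)
  then show "(deriv f has_real_derivative f2 t) (at t)"
    using DERIV_cong_ev[OF refl _ refl, THEN iffD2] f1[OF t(1)] by fast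
qed

lemma radial_solution_exists:
  assumes ab: "0 < a" "0 < b" and region: "(\<gamma>, \<delta>) \<in> region a b"
  shows "\<exists>u v M L C. ode_solution a b u v UNIV \<and>
    (\<forall>t. \<bar>u t\<bar> \<le> M * exp (- 2 * t) \<and> \<bar>v t\<bar> \<le> M * exp (- 2 * t)) \<and>
    (\<forall>t\<le>0. \<bar>u t - \<gamma> * t\<bar> \<le> L * ln (1 - t) + C \<and> \<bar>v t - \<delta> * t\<bar> \<le> L * ln (1 - t) + C) \<and>
    (- 2 / a < \<gamma> \<and> \<delta> < 2 / b \<and> \<gamma> - \<delta> < 2 \<longrightarrow>
      (\<exists>D. \<forall>t\<le>0. \<bar>u t - \<gamma> * t\<bar> \<le> D \<and> \<bar>v t - \<delta> * t\<bar> \<le> D))"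
proof -
  have "\<exists>u v. bvp_solution a b \<gamma> \<delta> (real (Suc n)) u v" for n
    using ode_bvp_solvable[OF ab, of "- real (Suc n)" "real (Suc n)"
        "- \<gamma> * real (Suc n)" "- \<delta> * real (Suc n)" 0 0] unfolding bvp_solution_def by simp
  then obtain u v where sol: "\<And>n. bvp_solution a b \<gamma> \<delta> (real (Suc n)) (u n) (v n)" by metis
  obtain M where M: "0 < M" "\<And>T u v t. 0 < T \<Longrightarrow> bvp_solution a b \<gamma> \<delta> T u v \<Longrightarrow> t \<in> {- T..T} \<Longrightarrow>
      \<bar>u t\<bar> \<le> M * exp (- 2 * t) \<and> \<bar>v t\<bar> \<le> M * exp (- 2 * t)"
    using bvp_solution_decay[OF ab, of \<gamma> \<delta>] by blast
  obtain L C where L: "0 \<le> L" "\<And>T u v t. 0 < T \<Longrightarrow> bvp_solution a b \<gamma> \<delta> T u v \<Longrightarrow> t \<in> {- T..0} \<Longrightarrow>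
      \<bar>u t - \<gamma> * t\<bar> \<le> L * ln (1 - t) + C \<and> \<bar>v t - \<delta> * t\<bar> \<le> L * ln (1 - t) + C"
    using bvp_solution_log_bound[OF ab region] by blast
  have decay: "\<bar>u n t\<bar> \<le> M * exp (- 2 * t)" "\<bar>v n t\<bar> \<le> M * exp (- 2 * t)" if "\<bar>t\<bar> \<le> real (Suc n)" for n t
  proof -
    have "t \<in> {- real (Suc n)..real (Suc n)}" using that unfolding atLeastAtMost_iff by linarith
    with M(2)[OF _ sol this] show "\<bar>u n t\<bar> \<le> M * exp (- 2 * t)" "\<bar>v n t\<bar> \<le> M * exp (- 2 * t)"
      by simp_all
  qed
  have log: "\<bar>u n t - \<gamma> * t\<bar> \<le> L * ln (1 - t) + C" "\<bar>v n t - \<delta> * t\<bar> \<le> L * ln (1 - t) + C"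
    if "t \<le> 0" "\<bar>t\<bar> \<le> real (Suc n)" for n t
    using L(2)[OF _ sol, of n t] that by auto
  \<comment> \<open>At the left end of the shorter interval both solutions are within the
    logarithmic bound of the same linear function; hence the factor 2.\<close>
  define l where "l n = 2 * (L * ln (1 + real (Suc n)) + C)" for n
  have diff: "\<bar>u n t - u m t\<bar> \<le> 2 * (M * exp (- 2 * R)) + l n * (R - t) / real (Suc n)"
    "\<bar>v n t - v m t\<bar> \<le> 2 * (M * exp (- 2 * R)) + l n * (R - t) / real (Suc n)"
    if "n \<le> m" "0 \<le> R" "\<bar>t\<bar> \<le> R" "R \<le> real (Suc n)" for n m t R
  proof -
    define J where "J = real (Suc n)"
    have J: "0 < J" "J \<le> real (Suc n)" "J \<le> real (Suc m)" "R \<le> real (Suc n)" "R \<le> real (Suc m)"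
      using that by (auto simp: J_def)
    have right: "\<bar>w R\<bar> \<le> M * exp (- 2 * R)" if "w \<in> {u n, v n, u m, v m}" for w
      using that decay[of R n] decay[of R m] J \<open>0 \<le> R\<close> by auto
    have right': "\<bar>w R\<bar> \<le> M * exp (- 2 * R)" if "w \<in> {u m, v m, u n, v n}" for w
      using right[of w] that by blast
    have left: "\<bar>u n (- J) - u m (- J)\<bar> \<le> l n" "\<bar>v n (- J) - v m (- J)\<bar> \<le> l n"
      using log[of "- J" n] log[of "- J" m] J unfolding l_def J_def by auto
    have t: "t \<in> {- J..R}" using that by (auto simp: J_def)
    have l0: "0 \<le> l n" using left(1) by linarith
    have "u n t \<le> u m t + (2 * (M * exp (- 2 * R)) + l n * (R - t) / J) \<and>
        v n t \<le> v m t + (2 * (M * exp (- 2 * R)) + l n * (R - t) / J)"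
      by (rule bvp_solution_le[OF ab \<open>0 \<le> R\<close> J(4,5) sol[of n] sol[of m] J(1,2,3) _ _ _ l0 t])
        (use right left in \<open>simp_all add: abs_le_iff\<close>)
    moreover have "u m t \<le> u n t + (2 * (M * exp (- 2 * R)) + l n * (R - t) / J) \<and>
        v m t \<le> v n t + (2 * (M * exp (- 2 * R)) + l n * (R - t) / J)"
      by (rule bvp_solution_le[OF ab \<open>0 \<le> R\<close> J(5,4) sol[of m] sol[of n] J(1,3,2) _ _ _ l0 t])
        (use right' left in \<open>simp_all add: abs_le_iff\<close>)
    ultimately show "\<bar>u n t - u m t\<bar> \<le> 2 * (M * exp (- 2 * R)) + l n * (R - t) / real (Suc n)"
      "\<bar>v n t - v m t\<bar> \<le> 2 * (M * exp (- 2 * R)) + l n * (R - t) / real (Suc n)"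
      unfolding J_def abs_le_iff by linarith+
  qed
  have l_lim: "(\<lambda>n. l n / real (Suc n)) \<longlonglongrightarrow> 0"
    unfolding l_def by real_asymp
  \<comment> \<open>First \<open>R\<close> is taken so large that decay makes the contribution of
    the right end small, then \<open>n\<close> so large that the affine slack is small, as
    \<open>l n\<close> grows only logarithmically.\<close>
  have small: "\<exists>N. \<forall>n\<ge>N. \<forall>m>n. \<bar>u n t - u m t\<bar> < e \<and> \<bar>v n t - v m t\<bar> < e" if e: "0 < e" for t e
  proof -
    have "((\<lambda>R. 2 * (M * exp (- 2 * R))) \<longlongrightarrow> 0) at_top" by real_asymp
    then have "\<forall>\<^sub>F R in at_top. 2 * (M * exp (- 2 * R)) < e / 2"
      by (rule order_tendstoD) (use e in simp)
    then obtain R where R: "\<bar>t\<bar> \<le> R" "2 * (M * exp (- 2 * R)) < e / 2"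
      using eventually_happens[OF eventually_conj[OF _ eventually_ge_at_top[of "\<bar>t\<bar>"]]] by force
    have "(\<lambda>n. (R - t) * (l n / real (Suc n))) \<longlonglongrightarrow> (R - t) * 0"
      by (intro tendsto_intros l_lim)
    then have "\<forall>\<^sub>F n in sequentially. (R - t) * (l n / real (Suc n)) < e / 2"
      by (rule order_tendstoD) (use e in simp)
    moreover have "\<forall>\<^sub>F n in sequentially. R \<le> real (Suc n)"
      by (intro eventually_sequentiallyI[of "nat \<lceil>R\<rceil>"]) linarith
    ultimately have "\<forall>\<^sub>F n in sequentially. (R - t) * (l n / real (Suc n)) < e / 2 \<and> R \<le> real (Suc n)"
      by (rule eventually_conj)
    then obtain N where N: "\<And>n. n \<ge> N \<Longrightarrow> (R - t) * (l n / real (Suc n)) < e / 2 \<and> R \<le> real (Suc n)"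
      unfolding eventually_sequentially by blast
    have "\<bar>u n t - u m t\<bar> < e \<and> \<bar>v n t - v m t\<bar> < e" if "n \<ge> N" "m > n" for n m
    proof -
      have eq: "l n * (R - t) / real (Suc n) = (R - t) * (l n / real (Suc n))" by simp
      show ?thesis
        using diff[of n m R t] N[OF that(1)] R that unfolding eq by linarith
    qed
    then show ?thesis by blast
  qed
  have "convergent (\<lambda>n. u n t)" "convergent (\<lambda>n. v n t)" for t
    unfolding Cauchy_convergent_iff[symmetric] Cauchy_altdef dist_real_def using small[of _ t] by meson+
  then obtain U V where UV: "\<And>t. (\<lambda>n. u n t) \<longlonglongrightarrow> U t" "\<And>t. (\<lambda>n. v n t) \<longlonglongrightarrow> V t"
    unfolding convergent_def by metis
  have ev: "\<forall>\<^sub>F n in sequentially. \<bar>t\<bar> \<le> real (Suc n)" for t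
    by (intro eventually_sequentiallyI[of "nat \<lceil>\<bar>t\<bar>\<rceil>"]) linarith
  have le: "\<bar>U t - c\<bar> \<le> B" if "\<And>n. \<bar>t\<bar> \<le> real (Suc n) \<Longrightarrow> \<bar>u n t - c\<bar> \<le> B" for t c B
    by (rule tendsto_upperbound[OF _ eventually_mono[OF ev[of t] that]]) (auto intro!: tendsto_intros UV)
  have le': "\<bar>V t - c\<bar> \<le> B" if "\<And>n. \<bar>t\<bar> \<le> real (Suc n) \<Longrightarrow> \<bar>v n t - c\<bar> \<le> B" for t c B
    by (rule tendsto_upperbound[OF _ eventually_mono[OF ev[of t] that]]) (auto intro!: tendsto_intros UV)
  have "ode_solution a b U V {- R<..<R}" if R: "0 < R" for R
  proof -
    \<comment> \<open>Dropping the first \<open>N\<close> terms leaves only solutions whose interval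
      contains \<open>{- R..R}\<close>.\<close>
    define N where "N = nat \<lceil>R\<rceil>"
    have N: "R \<le> real (Suc (n + N))" for n unfolding N_def by linarith
    have sub: "{- R..R} \<subseteq> {- real (Suc (n + N))..real (Suc (n + N))}"
      "{- R<..<R} \<subseteq> {- real (Suc (n + N))<..<real (Suc (n + N))}" for n
      using N[of n] by auto
    show ?thesis
    proof (rule ode_solution_limit[OF ab R, where u = "\<lambda>n. u (n + N)" and v = "\<lambda>n. v (n + N)" and B = "M * exp (2 * R)"])
      show "continuous_on {- R..R} (u (n + N))" "continuous_on {- R..R} (v (n + N))"
        "ode_solution a b (u (n + N)) (v (n + N)) {- R<..<R}" for n
        using sol[of "n + N"] sub[of n] unfolding bvp_solution_def
        by (meson continuous_on_subset ode_solution_subset)+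
      show "\<bar>u (n + N) t\<bar> \<le> M * exp (2 * R) \<and> \<bar>v (n + N) t\<bar> \<le> M * exp (2 * R)" if "t \<in> {- R..R}" for n t
      proof -
        have "M * exp (- 2 * t) \<le> M * exp (2 * R)" using M(1) that by simp
        moreover have "\<bar>t\<bar> \<le> real (Suc (n + N))" using that N[of n] by auto
        ultimately show ?thesis using decay[of t "n + N"] by linarith
      qed
    qed (intro LIMSEQ_ignore_initial_segment UV)+
  qed
  then have "ode_solution a b U V UNIV"
    unfolding ode_solution_def by (intro conjI has_deriv2_on_UNIV) blast+
  moreover have "\<forall>t. \<bar>U t\<bar> \<le> M * exp (- 2 * t) \<and> \<bar>V t\<bar> \<le> M * exp (- 2 * t)"
    using le[of _ 0] le'[of _ 0] decay by simp
  moreover have "\<forall>t\<le>0. \<bar>U t - \<gamma> * t\<bar> \<le> L * ln (1 - t) + C \<and> \<bar>V t - \<delta> * t\<bar> \<le> L * ln (1 - t) + C"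
    by (intro allI impI conjI le le' log)
  moreover have "\<exists>D. \<forall>t\<le>0. \<bar>U t - \<gamma> * t\<bar> \<le> D \<and> \<bar>V t - \<delta> * t\<bar> \<le> D"
    if strict: "- 2 / a < \<gamma> \<and> \<delta> < 2 / b \<and> \<gamma> - \<delta> < 2"
  proof -
    obtain D where D: "\<And>T u v t. 0 < T \<Longrightarrow> bvp_solution a b \<gamma> \<delta> T u v \<Longrightarrow> t \<in> {- T..0} \<Longrightarrow>
      \<bar>u t - \<gamma> * t\<bar> \<le> D \<and> \<bar>v t - \<delta> * t\<bar> \<le> D"
      using bvp_solution_interior_bound[OF ab, of \<gamma> \<delta>] strict by blast
    have "\<bar>u n t - \<gamma> * t\<bar> \<le> D" "\<bar>v n t - \<delta> * t\<bar> \<le> D" if "t \<le> 0" "\<bar>t\<bar> \<le> real (Suc n)" for n t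
      using D[OF _ sol, of n t] that by auto
    then show ?thesis by (intro exI[of _ D] allI impI conjI le le')
  qed
  ultimately show ?thesis by blast
qed

section \<open>Radial functions on the punctured plane\<close>

lemma Ck_on_cong:
  assumes "open S" "\<And>x. x \<in> S \<Longrightarrow> f x = g x" "Ck_on k S f"
  shows "Ck_on k S g"
  using assms(2,3)
proof (induction k arbitrary: f g)
  case 0
  then show ?case by (simp cong: continuous_on_cong)
next
  case (Suc k)
  have d: "f differentiable (at x)" if "x \<in> S" for x using Suc.prems(2) that by simp
  have fg: "frechet_derivative f (at x) = frechet_derivative g (at x)" if "x \<in> S" for x
    using frechet_derivative_transform_within_open[OF d[OF that] assms(1) that] Suc.prems(1) by blast
  have "g differentiable (at x)" if "x \<in> S" for x
    using d[OF that] has_derivative_transform_within_open[OF _ assms(1) that] Suc.prems(1)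
    unfolding differentiable_def by blast
  moreover have "Ck_on k S (\<lambda>x. frechet_derivative g (at x) h)" for h
  proof (rule Suc.IH)
    show "Ck_on k S (\<lambda>x. frechet_derivative f (at x) h)" using Suc.prems(2) by simp
  qed (simp add: fg)
  ultimately show ?case by simp
qed

text \<open>Closure under directional derivatives turns one differentiability statement into an
  induction over all orders, so sums, products and compositions need to be treated only for first
  derivatives.\<close>

lemma smooth_on_of_closed_class:
  assumes S: "open S"
    and A: "\<And>f. f \<in> A \<Longrightarrow> \<exists>f'. (\<forall>x\<in>S. (f has_derivative f' x) (at x)) \<and> (\<forall>h. (\<lambda>x. f' x h) \<in> A)"
    and f: "f \<in> A"
  shows "smooth_on S f"
proof -
  have "Ck_on k S f" for k
    using f
  proof (induction k arbitrary: f)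
    case 0
    then obtain f' where "\<forall>x\<in>S. (f has_derivative f' x) (at x)" using A by blast
    then show ?case
      by (auto intro!: continuous_at_imp_continuous_on has_derivative_continuous)
  next
    case (Suc k)
    obtain f' where f': "\<And>x. x \<in> S \<Longrightarrow> (f has_derivative f' x) (at x)" "\<And>h. (\<lambda>x. f' x h) \<in> A"
      using A[OF Suc.prems] by blast
    have "Ck_on k S (\<lambda>x. frechet_derivative f (at x) h)" for h
      by (rule Ck_on_cong[OF S _ Suc.IH[OF f'(2)[of h]]]) (simp add: frechet_derivative_at[OF f'(1), symmetric])
    then show ?case using f'(1) by (auto simp: differentiable_def)
  qed
  then show ?thesis by (simp add: smooth_on_def)
qed

definition dot :: "complex \<Rightarrow> complex \<Rightarrow> real" where
  "dot z h = Re z * Re h + Im z * Im h"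

lemma has_derivative_dot: "((\<lambda>w. dot w k) has_derivative (\<lambda>h. dot h k)) (at z)"
  unfolding dot_def by (auto intro!: derivative_eq_intros)

lemma has_derivative_cmod_sq: "((\<lambda>w. (cmod w)\<^sup>2) has_derivative (\<lambda>h. 2 * dot z h)) (at z)"
  unfolding cmod_power2 by (auto intro!: derivative_eq_intros simp: dot_def algebra_simps)

lemma has_derivative_inverse_cmod_sq:
  assumes "z \<noteq> 0"
  shows "((\<lambda>w. inverse ((cmod w)\<^sup>2)) has_derivative
           (\<lambda>h. - 2 * (dot z h * (inverse ((cmod z)\<^sup>2) * inverse ((cmod z)\<^sup>2))))) (at z)"
  using DERIV_compose_FDERIV[OF DERIV_inverse has_derivative_cmod_sq, of z] assms
  by (simp add: power2_eq_square mult.assoc)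

lemma has_derivative_ln_cmod:
  assumes "z \<noteq> 0"
  shows "((\<lambda>w. ln (cmod w)) has_derivative (\<lambda>h. dot z h * inverse ((cmod z)\<^sup>2))) (at z)"
proof -
  have "((\<lambda>w. ln ((cmod w)\<^sup>2)) has_derivative (\<lambda>h. 2 * dot z h * inverse ((cmod z)\<^sup>2))) (at z)"
    using DERIV_compose_FDERIV[OF DERIV_ln has_derivative_cmod_sq, of z] assms by simp
  from has_derivative_mult_right[OF this, of "1 / 2"] show ?thesis
    by (simp add: ln_realpow)
qed

lemma has_derivative_radial:
  assumes "\<And>t. (u has_real_derivative u1 t) (at t)" "z \<noteq> 0"
  shows "((\<lambda>w. u (ln (cmod w))) has_derivative
           (\<lambda>h. u1 (ln (cmod z)) * (dot z h * inverse ((cmod z)\<^sup>2)))) (at z)"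
  using DERIV_compose_FDERIV[OF assms(1) has_derivative_ln_cmod[OF assms(2)]]
  by (simp add: mult.commute)

text \<open>Membership in this algebra of functions on the punctured plane is preserved by directional derivatives,
  so that its elements are smooth.\<close>

inductive_set radial_algebra :: "(real \<Rightarrow> real) set \<Rightarrow> (complex \<Rightarrow> real) set" for P where
  const: "(\<lambda>_. c) \<in> radial_algebra P"
| dot: "(\<lambda>z. dot z k) \<in> radial_algebra P"
| inv: "(\<lambda>z. inverse ((cmod z)\<^sup>2)) \<in> radial_algebra P"
| radial: "p \<in> P \<Longrightarrow> (\<lambda>z. p (ln (cmod z))) \<in> radial_algebra P"
| add: "f \<in> radial_algebra P \<Longrightarrow> g \<in> radial_algebra P \<Longrightarrow> (\<lambda>z. f z + g z) \<in> radial_algebra P"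
| mult: "f \<in> radial_algebra P \<Longrightarrow> g \<in> radial_algebra P \<Longrightarrow> (\<lambda>z. f z * g z) \<in> radial_algebra P"
| exp: "f \<in> radial_algebra P \<Longrightarrow> (\<lambda>z. exp (f z)) \<in> radial_algebra P"

text \<open>The derivative of \<open>p (ln (cmod z))\<close> in direction \<open>h\<close> is
  \<open>dot z h\<close> times the function that \<open>P\<close> requires to be in the algebra.
  Membership of \<open>p'\<close> in \<open>P\<close> is not demanded, so a differential equation
  may express \<open>p'\<close> through other elements of the algebra.\<close>

lemma radial_algebra_smooth:
  assumes P: "\<And>p. p \<in> P \<Longrightarrow> \<exists>p'. (\<forall>t. (p has_real_derivative p' t) (at t)) \<and>
      (\<lambda>z. p' (ln (cmod z)) * inverse ((cmod z)\<^sup>2)) \<in> radial_algebra P"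
    and f: "f \<in> radial_algebra P"
  shows "smooth_on (- {0}) f"
proof (rule smooth_on_of_closed_class[OF _ _ f])
  show "open (- {0 :: complex})" by (simp add: open_Compl)
  let ?D = "\<lambda>f f'. (\<forall>x\<in>- {0}. (f has_derivative f' x) (at x)) \<and> (\<forall>h. (\<lambda>x. f' x h) \<in> radial_algebra P)"
  show "\<exists>f'. ?D f f'" if "f \<in> radial_algebra P" for f
    using that
  proof induction
    case (const c)
    show ?case
      by (rule exI[of _ "\<lambda>_ _. 0"]) (auto intro: radial_algebra.intros)
  next
    case (dot k)
    show ?case
      by (rule exI[of _ "\<lambda>_ h. dot h k"]) (auto intro: radial_algebra.intros has_derivative_dot)
  next
    case inv
    show ?case
      by (rule exI[of _ "\<lambda>z h. - 2 * (dot z h * (inverse ((cmod z)\<^sup>2) * inverse ((cmod z)\<^sup>2)))"])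
        (intro conjI allI ballI radial_algebra.intros has_derivative_inverse_cmod_sq, simp)
  next
    case (radial p)
    then obtain p' where p': "\<And>t. (p has_real_derivative p' t) (at t)"
      "(\<lambda>z. p' (ln (cmod z)) * inverse ((cmod z)\<^sup>2)) \<in> radial_algebra P"
      using P by blast
    have "(\<lambda>z. dot z h * (p' (ln (cmod z)) * inverse ((cmod z)\<^sup>2))) \<in> radial_algebra P" for h
      by (intro radial_algebra.mult radial_algebra.dot p'(2))
    moreover have "(\<lambda>h. p' (ln (cmod z)) * (dot z h * inverse ((cmod z)\<^sup>2))) =
        (\<lambda>h. dot z h * (p' (ln (cmod z)) * inverse ((cmod z)\<^sup>2)))" for z
      by (simp add: mult.left_commute)
    ultimately show ?case
      using has_derivative_radial[OF p'(1)]
      by (intro exI[of _ "\<lambda>z h. dot z h * (p' (ln (cmod z)) * inverse ((cmod z)\<^sup>2))"]) auto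
  next
    case (add f g)
    then obtain f' g' where "?D f f'" "?D g g'" by blast
    then show ?case
      by (intro exI[of _ "\<lambda>x h. f' x h + g' x h"]) (auto intro!: radial_algebra.add has_derivative_add)
  next
    case (mult f g)
    then obtain f' g' where D: "?D f f'" "?D g g'" by blast
    show ?case
    proof (intro exI[of _ "\<lambda>x h. f x * g' x h + f' x h * g x"] conjI ballI allI)
      show "((\<lambda>z. f z * g z) has_derivative (\<lambda>h. f x * g' x h + f' x h * g x)) (at x)" if "x \<in> - {0}" for x
        using D that by (intro has_derivative_mult) auto
      show "(\<lambda>x. f x * g' x h + f' x h * g x) \<in> radial_algebra P" for h
        using D mult.hyps by (intro radial_algebra.add radial_algebra.mult) auto
    qed
  next
    case (exp f)
    then obtain f' where D: "?D f f'" by blast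
    show ?case
    proof (intro exI[of _ "\<lambda>x h. f' x h * exp (f x)"] conjI ballI allI)
      show "((\<lambda>z. exp (f z)) has_derivative (\<lambda>h. f' x h * exp (f x))) (at x)" if "x \<in> - {0}" for x
        using DERIV_compose_FDERIV[OF DERIV_exp, of f "f' x" x UNIV] D that by auto
      show "(\<lambda>x. f' x h * exp (f x)) \<in> radial_algebra P" for h
        using D exp.hyps by (intro radial_algebra.mult radial_algebra.exp) auto
    qed
  qed
qed

definition twice_differentiable :: "(complex \<Rightarrow> real) \<Rightarrow> bool" where
  "twice_differentiable f \<longleftrightarrow> (\<forall>w. w \<noteq> 0 \<longrightarrow> f differentiable (at w) \<and>
     (\<forall>e. (\<lambda>w. frechet_derivative f (at w) e) differentiable (at w)))"

lemma smooth_on_imp_twice_differentiable: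
  assumes "smooth_on (- {0}) f"
  shows "twice_differentiable f"
proof -
  have "Ck_on (Suc (Suc 0)) (- {0}) f" using assms unfolding smooth_on_def by blast
  then show ?thesis unfolding twice_differentiable_def by simp
qed

lemma radial_second_derivative:
  assumes u: "\<And>t. (u has_real_derivative u1 t) (at t)" "\<And>t. (u1 has_real_derivative u2 t) (at t)"
    and z: "z \<noteq> 0"
  shows "((\<lambda>w. frechet_derivative (\<lambda>y. u (ln (cmod y))) (at w) k) has_derivative
     (\<lambda>h. u2 (ln (cmod z)) * (dot z h * dot z k) / (cmod z) ^ 4 +
        u1 (ln (cmod z)) * (dot h k / (cmod z)\<^sup>2 - 2 * (dot z h * dot z k) / (cmod z) ^ 4))) (at z)"
proof -
  let ?r = "inverse ((cmod z)\<^sup>2)"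
  have "((\<lambda>w. u1 (ln (cmod w)) * (dot w k * inverse ((cmod w)\<^sup>2))) has_derivative
      (\<lambda>h. u1 (ln (cmod z)) * (dot z k * (- 2 * (dot z h * (?r * ?r))) + dot h k * ?r) +
         u2 (ln (cmod z)) * (dot z h * ?r) * (dot z k * ?r))) (at z)"
    by (intro has_derivative_mult has_derivative_radial u has_derivative_dot has_derivative_inverse_cmod_sq z)
  moreover have "(\<lambda>h. u1 (ln (cmod z)) * (dot z k * (- 2 * (dot z h * (?r * ?r))) + dot h k * ?r) +
         u2 (ln (cmod z)) * (dot z h * ?r) * (dot z k * ?r)) =
      (\<lambda>h. u2 (ln (cmod z)) * (dot z h * dot z k) / (cmod z) ^ 4 +
        u1 (ln (cmod z)) * (dot h k / (cmod z)\<^sup>2 - 2 * (dot z h * dot z k) / (cmod z) ^ 4))"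
  proof
    fix h
    have r: "?r * ?r = inverse ((cmod z) ^ 4)"
      by (simp flip: inverse_mult_distrib power_add)
    have "u1 (ln (cmod z)) * (dot z k * (- 2 * (dot z h * (?r * ?r))) + dot h k * ?r) +
         u2 (ln (cmod z)) * (dot z h * ?r) * (dot z k * ?r) =
       u2 (ln (cmod z)) * (dot z h * dot z k) * (?r * ?r) +
        u1 (ln (cmod z)) * (dot h k * ?r - 2 * (dot z h * dot z k) * (?r * ?r))"
      by (simp only: algebra_simps)
    then show "u1 (ln (cmod z)) * (dot z k * (- 2 * (dot z h * (?r * ?r))) + dot h k * ?r) +
         u2 (ln (cmod z)) * (dot z h * ?r) * (dot z k * ?r) =
       u2 (ln (cmod z)) * (dot z h * dot z k) / (cmod z) ^ 4 +
        u1 (ln (cmod z)) * (dot h k / (cmod z)\<^sup>2 - 2 * (dot z h * dot z k) / (cmod z) ^ 4)"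
      unfolding r by (simp only: divide_inverse)
  qed
  ultimately have D: "((\<lambda>w. u1 (ln (cmod w)) * (dot w k * inverse ((cmod w)\<^sup>2))) has_derivative
      (\<lambda>h. u2 (ln (cmod z)) * (dot z h * dot z k) / (cmod z) ^ 4 +
        u1 (ln (cmod z)) * (dot h k / (cmod z)\<^sup>2 - 2 * (dot z h * dot z k) / (cmod z) ^ 4))) (at z)"
    by (simp only:)
  show ?thesis
  proof (rule has_derivative_transform_within_open[OF D, of "- {0}"])
    show "u1 (ln (cmod w)) * (dot w k * inverse ((cmod w)\<^sup>2)) =
        frechet_derivative (\<lambda>y. u (ln (cmod y))) (at w) k" if "w \<in> - {0}" for w
      using frechet_derivative_at[OF has_derivative_radial[OF u(1)], of w, symmetric] that by simp
  qed (use z in \<open>auto simp: open_Compl\<close>)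
qed

text \<open>Taking the trace of the second derivative, the \<open>u1\<close> terms give 2/|z|^2 -
  2|z|^2/|z|^4 = 0: in dimension two no first-order term remains.\<close>

lemma laplacian_radial:
  assumes u: "\<And>t. (u has_real_derivative u1 t) (at t)" "\<And>t. (u1 has_real_derivative u2 t) (at t)"
    and z: "z \<noteq> 0"
  shows "laplacian (\<lambda>w. u (ln (cmod w))) z = u2 (ln (cmod z)) / (cmod z)\<^sup>2"
proof -
  have sq: "dot z 1 * dot z 1 + dot z \<i> * dot z \<i> = (cmod z)\<^sup>2"
    unfolding dot_def cmod_power2 by (simp add: power2_eq_square)
  have one: "dot 1 1 = 1" "dot \<i> \<i> = 1" by (simp_all add: dot_def)
  define A B r U1 U2 where "A = dot z 1 * dot z 1" and "B = dot z \<i> * dot z \<i>" and "r = cmod z"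
    and "U1 = u1 (ln (cmod z))" and "U2 = u2 (ln (cmod z))"
  have r: "r \<noteq> 0" "A + B = r\<^sup>2" using z sq by (auto simp: A_def B_def r_def)
  have "laplacian (\<lambda>w. u (ln (cmod w))) z =
      (U2 * A / r ^ 4 + U1 * (1 / r\<^sup>2 - 2 * A / r ^ 4)) + (U2 * B / r ^ 4 + U1 * (1 / r\<^sup>2 - 2 * B / r ^ 4))"
    unfolding laplacian_complex
    by (simp only: frechet_derivative_at[OF radial_second_derivative[OF u z], symmetric] one A_def B_def r_def U1_def U2_def)
  also have "\<dots> = U2 * (A + B) / r ^ 4 + U1 * (2 / r\<^sup>2 - 2 * (A + B) / r ^ 4)"
    by (simp add: add_divide_distrib diff_divide_distrib algebra_simps)
  also have "\<dots> = U2 / r\<^sup>2"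
    unfolding r(2) using r(1) by (simp add: field_simps power2_eq_square eval_nat_numeral)
  finally show ?thesis by (simp add: U2_def r_def)
qed

lemma twice_differentiable_radial:
  assumes "\<And>t. (u has_real_derivative u1 t) (at t)" "\<And>t. (u1 has_real_derivative u2 t) (at t)"
  shows "twice_differentiable (\<lambda>w. u (ln (cmod w)))"
  unfolding twice_differentiable_def
  using has_derivative_radial[OF assms(1)] radial_second_derivative[OF assms]
  unfolding differentiable_def by blast

lemma twice_differentiable_along_line:
  assumes "twice_differentiable f"
  shows "has_deriv2_on (\<lambda>s. f (z + s *\<^sub>R e))
    (\<lambda>s. frechet_derivative (\<lambda>w. frechet_derivative f (at w) e) (at (z + s *\<^sub>R e)) e) {s. z + s *\<^sub>R e \<noteq> 0}"
proof -
  have line: "((\<lambda>s. g (z + s *\<^sub>R e)) has_real_derivative frechet_derivative g (at (z + t *\<^sub>R e)) e) (at t)"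
    if "g differentiable (at (z + t *\<^sub>R e))" for g :: "complex \<Rightarrow> real" and t
  proof -
    have g: "(g has_derivative frechet_derivative g (at (z + t *\<^sub>R e))) (at (z + t *\<^sub>R e))"
      using that frechet_derivative_works by blast
    have "((\<lambda>s. g (z + s *\<^sub>R e)) has_derivative (\<lambda>s. frechet_derivative g (at (z + t *\<^sub>R e)) (s *\<^sub>R e))) (at t)"
    proof -
      have "((\<lambda>s. z + s *\<^sub>R e) has_derivative (\<lambda>s. s *\<^sub>R e)) (at t)"
        by (auto intro!: derivative_eq_intros)
      from has_derivative_compose[OF this, of g "frechet_derivative g (at (z + t *\<^sub>R e))"] g show ?thesis by simp
    qed
    moreover have "frechet_derivative g (at (z + t *\<^sub>R e)) (s *\<^sub>R e) = frechet_derivative g (at (z + t *\<^sub>R e)) e * s" for s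
      using linear_scale[OF has_derivative_linear[OF g]] by (simp add: mult.commute)
    ultimately show ?thesis by (simp add: has_field_derivative_def)
  qed
  show ?thesis
    by (rule has_deriv2_onI[where ?f1.0 = "\<lambda>s. frechet_derivative f (at (z + s *\<^sub>R e)) e"])
      (use assms in \<open>auto simp: twice_differentiable_def intro!: line\<close>)
qed

text \<open>The Laplacian is the sum of two axis second derivatives, so one of them is positive for
  the difference, and the one-dimensional test applies along that axis. The three functions are kept
  apart to match a solution, its competitor and the harmonic slack; differences are formed only
  along lines.\<close>

lemma laplacian_pos_not_local_max:
  assumes "twice_differentiable f" "twice_differentiable g" "twice_differentiable h"
    and z: "z \<noteq> 0" and pos: "0 < laplacian f z - laplacian g z - laplacian h z" and r: "0 < r"
  shows "\<exists>w. cmod (w - z) < r \<and> f z - g z - h z < f w - g w - h w"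
proof -
  let ?D = "\<lambda>f e s. frechet_derivative (\<lambda>w. frechet_derivative f (at w) e) (at (z + s *\<^sub>R e)) e"
  have *: "\<exists>w. cmod (w - z) < r \<and> f z - g z - h z < f w - g w - h w"
    if "0 < ?D f e 0 - ?D g e 0 - ?D h e 0" "cmod e = 1" for e
  proof -
    have D: "has_deriv2_on (\<lambda>s. f (z + s *\<^sub>R e) - g (z + s *\<^sub>R e) - h (z + s *\<^sub>R e))
        (\<lambda>s. ?D f e s - ?D g e s - ?D h e s) {s. z + s *\<^sub>R e \<noteq> 0}"
      by (intro has_deriv2_on_diff twice_differentiable_along_line assms)
    have "open {s. z + s *\<^sub>R e \<noteq> 0}"
      by (intro open_Collect_neq continuous_intros)
    from deriv2_pos_not_local_max[OF D this _ that(1) r] z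
    obtain s where s: "\<bar>s\<bar> < r" "f z - g z - h z < f (z + s *\<^sub>R e) - g (z + s *\<^sub>R e) - h (z + s *\<^sub>R e)"
      by auto
    then show ?thesis using that(2) by (intro exI[of _ "z + s *\<^sub>R e"]) simp
  qed
  have "0 < (?D f 1 0 - ?D g 1 0 - ?D h 1 0) + (?D f \<i> 0 - ?D g \<i> 0 - ?D h \<i> 0)"
    using pos unfolding laplacian_complex by simp
  then have "0 < ?D f 1 0 - ?D g 1 0 - ?D h 1 0 \<or> 0 < ?D f \<i> 0 - ?D g \<i> 0 - ?D h \<i> 0" by linarith
  then show ?thesis using *[of 1] *[of \<i>] by auto
qed

section \<open>Comparison and uniqueness on the punctured plane\<close>

lemma log_asymptotics_close:
  assumes "log_asymptotics c f" "log_asymptotics c g" "0 < \<epsilon>"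
  shows "\<forall>\<^sub>F w in at 0. \<bar>f w - g w\<bar> \<le> \<epsilon> * \<bar>ln (cmod w)\<bar>"
proof -
  obtain e1 e2 where e: "(e1 \<longlongrightarrow> 0) (at 0)" "(e2 \<longlongrightarrow> 0) (at 0)"
    "\<forall>\<^sub>F w in at 0. f w = (c + e1 w) * ln (cmod w)" "\<forall>\<^sub>F w in at 0. g w = (c + e2 w) * ln (cmod w)"
    using assms(1,2) unfolding log_asymptotics_def by blast
  have "((\<lambda>w. \<bar>e1 w - e2 w\<bar>) \<longlongrightarrow> \<bar>0 - 0\<bar>) (at 0)" by (intro tendsto_intros e)
  then have "\<forall>\<^sub>F w in at 0. \<bar>e1 w - e2 w\<bar> < \<epsilon>" by (rule order_tendstoD) (use assms(3) in simp)
  with e(3,4) show ?thesis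
  proof eventually_elim
    case (elim w)
    have "f w - g w = (e1 w - e2 w) * ln (cmod w)" using elim by (simp add: algebra_simps)
    then show ?case using elim(3) by (simp add: abs_mult mult_right_mono)
  qed
qed

lemma solves_system_laplacian:
  assumes "solves_system a b u v" "z \<noteq> 0"
  shows "laplacian u z = rhs1 a 0 (u z) (v z)" "laplacian v z = rhs2 b 0 (u z) (v z)"
  using assms by (auto simp: solves_system_def d_z_zbar_def rhs1_def rhs2_def field_simps)

lemma is_solution_le:
  assumes ab: "0 < a" "0 < b" and sol: "is_solution a b \<gamma> \<delta> u v" "is_solution a b \<gamma> \<delta> U V"
    and z: "z \<noteq> 0"
  shows "u z \<le> U z \<and> v z \<le> V z"
proof -
  have sys: "solves_system a b u v" "solves_system a b U V"
    using sol by (simp_all add: is_solution_def)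
  have C2: "twice_differentiable u" "twice_differentiable v" "twice_differentiable U" "twice_differentiable V"
    using sys by (auto simp: solves_system_def intro: smooth_on_imp_twice_differentiable)
  have main: "u z \<le> U z + 2 * \<eta> \<and> v z \<le> V z + 2 * \<eta>" if \<eta>: "0 < \<eta>" for \<eta>
  proof -
    have "((\<lambda>w. u w - U w) \<longlongrightarrow> 0 - 0) at_infinity" "((\<lambda>w. v w - V w) \<longlongrightarrow> 0 - 0) at_infinity"
      using sol unfolding is_solution_def by (intro tendsto_intros; simp)+
    then have "\<forall>\<^sub>F w in at_infinity. u w - U w < \<eta>" "\<forall>\<^sub>F w in at_infinity. v w - V w < \<eta>"
      using \<eta> by (auto dest: order_tendstoD(2)[where a = \<eta>])
    then have "\<forall>\<^sub>F w in at_infinity. u w - U w < \<eta> \<and> v w - V w < \<eta>" by (rule eventually_conj)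
    then obtain R0 where R0: "\<And>w. R0 \<le> cmod w \<Longrightarrow> u w - U w < \<eta> \<and> v w - V w < \<eta>"
      unfolding eventually_at_infinity by blast
    define R where "R = max R0 (max 1 (cmod z))"
    have R: "R0 \<le> R" "1 \<le> R" "cmod z \<le> R" "0 \<le> ln R" by (auto simp: R_def)
    have lz: "ln (cmod z) \<le> ln R" using z R by simp
    \<comment> \<open>The order of choices matters: \<open>R\<close> comes from decay at infinity,
      then \<epsilon> is small enough that the slack at the fixed point \<open>z\<close> is at most
      \<open>2 * \<eta>\<close>, and only then is the inner radius chosen from \<epsilon>.\<close>
    define \<epsilon> where "\<epsilon> = \<eta> / (1 + (ln R - ln (cmod z)))"
    have \<epsilon>: "0 < \<epsilon>" "\<epsilon> * (ln R - ln (cmod z)) \<le> \<eta>"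
      using \<eta> lz by (auto simp: \<epsilon>_def field_simps)
    have "\<forall>\<^sub>F w in at 0. \<bar>u w - U w\<bar> \<le> \<epsilon> * \<bar>ln (cmod w)\<bar> \<and> \<bar>v w - V w\<bar> \<le> \<epsilon> * \<bar>ln (cmod w)\<bar>"
      using sol \<epsilon>(1) unfolding is_solution_def
      by (intro eventually_conj log_asymptotics_close) auto
    then obtain \<rho> where \<rho>: "0 < \<rho>" "\<And>w. w \<noteq> 0 \<Longrightarrow> cmod w < \<rho> \<Longrightarrow>
        \<bar>u w - U w\<bar> \<le> \<epsilon> * \<bar>ln (cmod w)\<bar> \<and> \<bar>v w - V w\<bar> \<le> \<epsilon> * \<bar>ln (cmod w)\<bar>"
      unfolding eventually_at by (auto simp: dist_norm)
    \<comment> \<open>Keeps \<open>z\<close> in the annulus, puts the inner circle where the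
      difference is at most \<open>\<epsilon> * \<bar>ln (cmod w)\<bar>\<close>, and makes
      \<open>ln r\<close> negative so that this bound equals the logarithmic part of the
      slack.\<close>
    define r where "r = min (cmod z) (min (\<rho> / 2) (1 / 2))"
    have r: "0 < r" "r \<le> cmod z" "r < \<rho>" "r < 1" using z \<rho>(1) by (auto simp: r_def)
    define S where "S = {w. r \<le> cmod w \<and> cmod w \<le> R}"
    define \<phi> where "\<phi> w = (\<eta> + \<epsilon> * ln R) + (- \<epsilon>) * ln (cmod w)" for w :: complex
    have \<phi>_eq: "\<phi> w = \<eta> + \<epsilon> * (ln R - ln (cmod w))" for w
      by (simp add: \<phi>_def algebra_simps)
    have nz: "w \<noteq> 0" if "w \<in> S" for w using that r(1) by (auto simp: S_def)
    have \<phi>_pos: "\<eta> \<le> \<phi> w" if "w \<in> S" for w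
    proof -
      have "0 < cmod w" "cmod w \<le> R" using that r(1) by (auto simp: S_def)
      then have "ln (cmod w) \<le> ln R" using R(2) by simp
      then show ?thesis using \<epsilon>(1) by (simp add: \<phi>_eq)
    qed
    have der: "((\<lambda>t. (\<eta> + \<epsilon> * ln R) + (- \<epsilon>) * t) has_real_derivative - \<epsilon>) (at t)" for t
      by (auto intro!: derivative_eq_intros)
    have lap_\<phi>: "laplacian \<phi> w = 0" if "w \<noteq> 0" for w
      unfolding \<phi>_def using laplacian_radial[OF der DERIV_const that] by simp
    have C2_\<phi>: "twice_differentiable \<phi>"
      unfolding \<phi>_def by (rule twice_differentiable_radial[OF der DERIV_const])
    have compact: "compact S"
    proof -
      have "S = cball 0 R - ball 0 r" by (auto simp: S_def)
      then show ?thesis by (simp add: compact_diff)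
    qed
    have cont: "continuous_on S f" if "twice_differentiable f" for f
      using that nz unfolding twice_differentiable_def
      by (meson continuous_at_imp_continuous_on differentiable_imp_continuous_within)
    have bdry: "f w - F w - \<phi> w \<le> 0" if w: "w \<in> S" and out: "\<not> (r < cmod w \<and> cmod w < R)"
      and 1: "\<And>w. R0 \<le> cmod w \<Longrightarrow> f w - F w < \<eta>"
      and 2: "\<And>w. w \<noteq> 0 \<Longrightarrow> cmod w < \<rho> \<Longrightarrow> \<bar>f w - F w\<bar> \<le> \<epsilon> * \<bar>ln (cmod w)\<bar>" for f F :: "complex \<Rightarrow> real" and w
    proof -
      consider "cmod w = r" | "cmod w = R" using w out unfolding S_def by force
      then show ?thesis
      proof cases
        assume cw: "cmod w = r"
        have "ln r < 0" using r by simp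
        then have "f w - F w \<le> \<epsilon> * (- ln (cmod w))" using 2[OF nz[OF w]] r cw by auto
        moreover have "0 \<le> \<epsilon> * ln R" using \<epsilon> R by simp
        ultimately show ?thesis using \<eta> unfolding \<phi>_def by simp
      next
        assume "cmod w = R"
        then show ?thesis using 1[of w] R \<phi>_pos[OF w] by simp
      qed
    qed
    \<comment> \<open>A positive excess rules out both boundary circles, so a whole disc around
      \<open>w\<close> lies in the annulus; there the harmonic slack leaves the sign of the
      Laplacian unchanged.\<close>
    have inner: "\<exists>y\<in>S. f w - F w - \<phi> w < f y - F y - \<phi> y"
      if w: "w \<in> S" and C2: "twice_differentiable f" "twice_differentiable F"
        and pos: "0 < laplacian f w - laplacian F w" "0 < f w - F w - \<phi> w"
      and 1: "\<And>w. R0 \<le> cmod w \<Longrightarrow> f w - F w < \<eta>"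
      and 2: "\<And>w. w \<noteq> 0 \<Longrightarrow> cmod w < \<rho> \<Longrightarrow> \<bar>f w - F w\<bar> \<le> \<epsilon> * \<bar>ln (cmod w)\<bar>" for f F :: "complex \<Rightarrow> real" and w
    proof -
      have in_S: "r < cmod w" "cmod w < R"
        using bdry[OF w _ 1 2] pos(2) by force+
      obtain y where y: "cmod (y - w) < min (cmod w - r) (R - cmod w)" "f w - F w - \<phi> w < f y - F y - \<phi> y"
        using laplacian_pos_not_local_max[OF C2 C2_\<phi> nz[OF w], of "min (cmod w - r) (R - cmod w)"]
          in_S pos(1) lap_\<phi>[OF nz[OF w]] by auto
      have "y \<in> S"
        using y(1) norm_triangle_ineq2[of w y] norm_triangle_ineq2[of y w] by (auto simp: S_def norm_minus_commute)
      with y show ?thesis by blast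
    qed
    have "u z - U z - \<phi> z \<le> 0 \<and> v z - V z - \<phi> z \<le> 0"
    proof (rule compact_pair_max_principle[OF compact, of "\<lambda>w. u w - U w - \<phi> w" "\<lambda>w. v w - V w - \<phi> w"])
      show "continuous_on S (\<lambda>w. u w - U w - \<phi> w)" "continuous_on S (\<lambda>w. v w - V w - \<phi> w)"
        by (intro continuous_intros cont C2 C2_\<phi>)+
      show "z \<in> S" using r R by (simp add: S_def)
      show "\<exists>y\<in>S. u w - U w - \<phi> w < u y - U y - \<phi> y"
        if w: "w \<in> S" and pos: "0 < u w - U w - \<phi> w" and le: "v w - V w - \<phi> w \<le> u w - U w - \<phi> w" for w
      proof (rule inner[OF w C2(1,3) _ pos])
        show "0 < laplacian u w - laplacian U w"
          using rhs1_strict_mono[OF ab(1), of "U w" "u w" "v w" "V w" 0] \<phi>_pos[OF w] \<eta> pos le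
          by (simp add: solves_system_laplacian[OF sys(1) nz[OF w]] solves_system_laplacian[OF sys(2) nz[OF w]])
      qed (use R0 \<rho>(2) in blast)+
      show "\<exists>y\<in>S. v w - V w - \<phi> w < v y - V y - \<phi> y"
        if w: "w \<in> S" and pos: "0 < v w - V w - \<phi> w" and le: "u w - U w - \<phi> w \<le> v w - V w - \<phi> w" for w
      proof (rule inner[OF w C2(2,4) _ pos])
        show "0 < laplacian v w - laplacian V w"
          using rhs2_strict_mono[OF ab(2), of "V w" "v w" "u w" "U w" 0] \<phi>_pos[OF w] \<eta> pos le
          by (simp add: solves_system_laplacian[OF sys(1) nz[OF w]] solves_system_laplacian[OF sys(2) nz[OF w]])
      qed (use R0 \<rho>(2) in blast)+
    qed
    moreover have "\<phi> z \<le> 2 * \<eta>" using \<epsilon>(2) by (simp add: \<phi>_eq)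
    ultimately show ?thesis by linarith
  qed
  have "u z \<le> U z + e \<and> v z \<le> V z + e" if "0 < e" for e
    using main[of "e / 2"] that by simp
  then show ?thesis by (meson field_le_epsilon)
qed

lemma is_solution_unique:
  assumes "0 < a" "0 < b" "is_solution a b \<gamma> \<delta> u v" "is_solution a b \<gamma> \<delta> U V" "z \<noteq> 0"
  shows "u z = U z \<and> v z = V z"
  using is_solution_le[OF assms] is_solution_le[OF assms(1,2,4,3,5)] by linarith

section \<open>Transfer of the solution on the line to the punctured plane\<close>

lemma solves_system_radial:
  assumes "ode_solution a b u v UNIV"
  shows "solves_system a b (\<lambda>z. u (ln (cmod z))) (\<lambda>z. v (ln (cmod z)))"
proof -
  obtain u1 v1 where u: "\<And>t. (u has_real_derivative u1 t) (at t)" "\<And>t. (u1 has_real_derivative rhs1 a t (u t) (v t)) (at t)"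
    and v: "\<And>t. (v has_real_derivative v1 t) (at t)" "\<And>t. (v1 has_real_derivative rhs2 b t (u t) (v t)) (at t)"
    using assms unfolding ode_solution_def has_deriv2_on_def by auto
  \<comment> \<open>The derivatives of \<open>u1\<close> and \<open>v1\<close> are given by the
    system, hence are built from \<open>u\<close>, \<open>v\<close> and \<open>exp (2 * t)\<close>
    by the algebra operations; this closes the family under differentiation.\<close>
  let ?P = "{\<lambda>t. exp (2 * t), u, v, u1, v1}"
  have gen: "(\<lambda>z. p (ln (cmod z))) \<in> radial_algebra ?P" if "p \<in> ?P" for p
    using that by (rule radial_algebra.radial)
  have scaled: "(\<lambda>z. c * f z) \<in> radial_algebra ?P" if "f \<in> radial_algebra ?P" for c f
    using radial_algebra.mult[OF radial_algebra.const that] .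
  have diff: "(\<lambda>z. f z - g z) \<in> radial_algebra ?P" if "f \<in> radial_algebra ?P" "g \<in> radial_algebra ?P" for f g
    using radial_algebra.add[OF that(1) scaled[OF that(2), of "- 1"]] by simp
  have uv: "(\<lambda>z. u (ln (cmod z))) \<in> radial_algebra ?P" "(\<lambda>z. v (ln (cmod z))) \<in> radial_algebra ?P"
    "(\<lambda>z. u1 (ln (cmod z))) \<in> radial_algebra ?P" "(\<lambda>z. v1 (ln (cmod z))) \<in> radial_algebra ?P"
    "(\<lambda>z. exp (2 * ln (cmod z))) \<in> radial_algebra ?P"
    using gen[of u] gen[of v] gen[of u1] gen[of v1] gen[of "\<lambda>t. exp (2 * t)"] by simp_all
  have rhs: "(\<lambda>z. rhs1 a (ln (cmod z)) (u (ln (cmod z))) (v (ln (cmod z)))) \<in> radial_algebra ?P"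
    "(\<lambda>z. rhs2 b (ln (cmod z)) (u (ln (cmod z))) (v (ln (cmod z)))) \<in> radial_algebra ?P"
    unfolding rhs1_def rhs2_def
    by (intro radial_algebra.mult radial_algebra.const radial_algebra.exp diff scaled uv)+
  have smooth: "smooth_on (- {0}) f" if "f \<in> radial_algebra ?P" for f
  proof (rule radial_algebra_smooth[OF _ that])
    have *: "\<exists>p'. (\<forall>t. (p has_real_derivative p' t) (at t)) \<and>
        (\<lambda>z. p' (ln (cmod z)) * inverse ((cmod z)\<^sup>2)) \<in> radial_algebra ?P"
      if "\<And>t. (p has_real_derivative p' t) (at t)" "(\<lambda>z. p' (ln (cmod z))) \<in> radial_algebra ?P" for p p'
      using that radial_algebra.mult[OF that(2) radial_algebra.inv] by blast
    fix p assume "p \<in> ?P"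
    then consider "p = (\<lambda>t. exp (2 * t))" | "p = u" | "p = v" | "p = u1" | "p = v1" by blast
    then show "\<exists>p'. (\<forall>t. (p has_real_derivative p' t) (at t)) \<and>
        (\<lambda>z. p' (ln (cmod z)) * inverse ((cmod z)\<^sup>2)) \<in> radial_algebra ?P"
    proof cases
      case 1
      show ?thesis unfolding 1
        by (rule *[of _ "\<lambda>t. 2 * exp (2 * t)"]) (auto intro!: derivative_eq_intros scaled uv)
    next
      case 2
      show ?thesis unfolding 2 by (rule *[OF u(1) uv(3)])
    next
      case 3
      show ?thesis unfolding 3 by (rule *[OF v(1) uv(4)])
    next
      case 4
      show ?thesis unfolding 4 by (rule *[OF u(2) rhs(1)])
    next
      case 5
      show ?thesis unfolding 5 by (rule *[OF v(2) rhs(2)])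
    qed
  qed
  have sq: "exp (2 * ln (cmod z)) = (cmod z)\<^sup>2" if "z \<noteq> 0" for z
    using that by (simp add: exp_double)
  show ?thesis
    unfolding solves_system_def d_z_zbar_def
    using smooth[OF uv(1)] smooth[OF uv(2)]
    by (auto simp: laplacian_radial[OF u] laplacian_radial[OF v] rhs1_def rhs2_def sq)
qed

lemma filterlim_ln_cmod: "filterlim (\<lambda>z. ln (cmod z)) at_bot (at 0)"
proof (rule filterlim_compose[OF ln_at_0])
  have "((\<lambda>z. cmod z) \<longlongrightarrow> cmod 0) (at 0)" by (intro tendsto_intros)
  then show "filterlim cmod (at_right 0) (at 0)"
    by (auto simp: filterlim_at eventually_at_filter)
qed

text \<open>The witness for the vanishing correction is \<open>(w t - c * t) / t\<close> at
  \<open>t = ln (cmod z)\<close>, and \<open>ln (1 - t)\<close> is o(t) at -infinity.\<close>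

lemma log_asymptotics_radial:
  fixes w :: "real \<Rightarrow> real"
  assumes "\<And>t. t \<le> 0 \<Longrightarrow> \<bar>w t - c * t\<bar> \<le> L * ln (1 - t) + C"
  shows "log_asymptotics c (\<lambda>z. w (ln (cmod z)))"
proof -
  have "((\<lambda>t. (w t - c * t) / t) \<longlongrightarrow> 0) at_bot"
  proof (rule Lim_null_comparison)
    show "((\<lambda>t. (L * ln (1 - t) + C) / - t) \<longlongrightarrow> 0) at_bot" by real_asymp
    show "\<forall>\<^sub>F t in at_bot. norm ((w t - c * t) / t) \<le> (L * ln (1 - t) + C) / - t"
      using eventually_gt_at_bot[of 0]
    proof eventually_elim
      case (elim t)
      then have "norm ((w t - c * t) / t) = \<bar>w t - c * t\<bar> / - t" by (simp add: abs_divide)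
      also have "\<dots> \<le> (L * ln (1 - t) + C) / - t"
        using elim assms[of t] by (intro divide_right_mono) auto
      finally show ?case .
    qed
  qed
  then have "((\<lambda>z. (w (ln (cmod z)) - c * ln (cmod z)) / ln (cmod z)) \<longlongrightarrow> 0) (at 0)"
    by (rule filterlim_compose[OF _ filterlim_ln_cmod])
  moreover have "\<forall>\<^sub>F z in at 0. w (ln (cmod z)) =
      (c + (w (ln (cmod z)) - c * ln (cmod z)) / ln (cmod z)) * ln (cmod z)"
    using filterlim_ln_cmod[unfolded filterlim_at_bot_dense, rule_format, of 0]
    by eventually_elim (simp add: field_simps)
  ultimately show ?thesis unfolding log_asymptotics_def by blast
qed

lemma decay_radial:
  fixes w :: "real \<Rightarrow> real"
  assumes "\<And>t. \<bar>w t\<bar> \<le> M * exp (- 2 * t)"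
  shows "((\<lambda>z. w (ln (cmod z))) \<longlongrightarrow> 0) at_infinity"
proof -
  have "(w \<longlongrightarrow> 0) at_top"
  proof (rule Lim_null_comparison)
    show "((\<lambda>t. M * exp (- 2 * t)) \<longlongrightarrow> 0) at_top" by real_asymp
  qed (use assms in simp)
  then show ?thesis
    by (rule filterlim_compose[OF _ filterlim_compose[OF ln_at_top filterlim_norm_at_top]])
qed

text \<open>Moving the point by \<open>e / 2\<close> in the direction that worsens each inequality
  stays in the region.\<close>

lemma interior_region_strict:
  assumes "(\<gamma>, \<delta>) \<in> interior (region a b)"
  shows "- 2 / a < \<gamma>" "\<delta> < 2 / b" "\<gamma> - \<delta> < 2"
proof -
  obtain e where e: "0 < e" "ball (\<gamma>, \<delta>) e \<subseteq> region a b"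
    using assms unfolding mem_interior by blast
  have "(\<gamma> - e / 2, \<delta>) \<in> region a b" "(\<gamma>, \<delta> + e / 2) \<in> region a b" "(\<gamma> + e / 2, \<delta>) \<in> region a b"
    by (rule subsetD[OF e(2)], use e(1) in \<open>simp add: dist_Pair_Pair dist_real_def\<close>)+
  then show "- 2 / a < \<gamma>" "\<delta> < 2 / b" "\<gamma> - \<delta> < 2"
    using e(1) unfolding region_def by auto
qed

lemma bigo_radial:
  fixes w :: "real \<Rightarrow> real"
  assumes "\<And>t. t \<le> 0 \<Longrightarrow> \<bar>w t - c * t\<bar> \<le> D"
  shows "(\<lambda>z. w (ln (cmod z)) - c * ln (cmod z)) \<in> O[at 0](\<lambda>_. 1)"
proof (rule bigoI)
  show "\<forall>\<^sub>F z in at 0. norm (w (ln (cmod z)) - c * ln (cmod z)) \<le> D * norm (1 :: real)"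
    using filterlim_ln_cmod[unfolded filterlim_at_bot_dense, rule_format, of 0]
    by eventually_elim (use assms in simp)
qed

text \<open>Radial symmetry comes from the construction on the line, whereas uniqueness is proved
  against arbitrary solutions on the punctured plane; so no solution other than the radial one
  exists.\<close>

theorem theoremA:
  fixes a b \<gamma> \<delta> :: real
  assumes "a > 0" and "b > 0"
    and "(\<gamma>, \<delta>) \<in> region a b"
  shows "\<exists>u v :: complex \<Rightarrow> real.
           is_solution a b \<gamma> \<delta> u v \<and>
           (\<forall>u' v'. is_solution a b \<gamma> \<delta> u' v' \<longrightarrow>
              (\<forall>z. z \<noteq> 0 \<longrightarrow> u' z = u z \<and> v' z = v z)) \<and>
           ((\<gamma>, \<delta>) \<in> interior (region a b) \<longrightarrow>
              (\<lambda>z. u z - \<gamma> * ln (cmod z)) \<in> O[at 0](\<lambda>_. 1) \<and>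
              (\<lambda>z. v z - \<delta> * ln (cmod z)) \<in> O[at 0](\<lambda>_. 1)) \<and>
           (\<forall>z w. z \<noteq> 0 \<longrightarrow> w \<noteq> 0 \<longrightarrow> cmod z = cmod w \<longrightarrow> u z = u w \<and> v z = v w)"
proof -
  obtain u v M L C where sol: "ode_solution a b u v UNIV"
    and decay: "\<And>t. \<bar>u t\<bar> \<le> M * exp (- 2 * t)" "\<And>t. \<bar>v t\<bar> \<le> M * exp (- 2 * t)"
    and log: "\<And>t. t \<le> 0 \<Longrightarrow> \<bar>u t - \<gamma> * t\<bar> \<le> L * ln (1 - t) + C"
      "\<And>t. t \<le> 0 \<Longrightarrow> \<bar>v t - \<delta> * t\<bar> \<le> L * ln (1 - t) + C"
    and strict: "- 2 / a < \<gamma> \<and> \<delta> < 2 / b \<and> \<gamma> - \<delta> < 2 \<longrightarrow>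
      (\<exists>D. \<forall>t\<le>0. \<bar>u t - \<gamma> * t\<bar> \<le> D \<and> \<bar>v t - \<delta> * t\<bar> \<le> D)"
    using radial_solution_exists[OF assms] by metis
  define U where "U z = u (ln (cmod z))" for z
  define V where "V z = v (ln (cmod z))" for z
  have is_sol: "is_solution a b \<gamma> \<delta> U V"
    unfolding is_solution_def U_def V_def
    by (intro conjI solves_system_radial[OF sol] decay_radial[OF decay(1)] decay_radial[OF decay(2)]
        log_asymptotics_radial[OF log(1)] log_asymptotics_radial[OF log(2)])
  show ?thesis
  proof (rule exI[of _ U], rule exI[of _ V], intro conjI is_sol allI impI)
    fix u' v' and z :: complex
    assume "is_solution a b \<gamma> \<delta> u' v'" "z \<noteq> 0"
    then show "u' z = U z" "v' z = V z"
      using is_solution_unique[OF assms(1,2) _ is_sol] by blast+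
  next
    assume "(\<gamma>, \<delta>) \<in> interior (region a b)"
    then obtain D where D: "\<And>t. t \<le> 0 \<Longrightarrow> \<bar>u t - \<gamma> * t\<bar> \<le> D" "\<And>t. t \<le> 0 \<Longrightarrow> \<bar>v t - \<delta> * t\<bar> \<le> D"
      using strict interior_region_strict by meson
    show "(\<lambda>z. U z - \<gamma> * ln (cmod z)) \<in> O[at 0](\<lambda>_. 1)" "(\<lambda>z. V z - \<delta> * ln (cmod z)) \<in> O[at 0](\<lambda>_. 1)"
      unfolding U_def V_def by (rule bigo_radial[OF D(1)] bigo_radial[OF D(2)], assumption)+
  qed (simp_all add: U_def V_def)
qed

end
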